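(* Let $M$ be a countable complete metric space. Then $\mathcal{F}(M)$ has the approximation property. More generally, let $M$ be a scattered complete metric space. Then $\mathcal{F}(M)$ has the approximation property.
   Context: All metric spaces come with a distinguished base point $0$. $\mathrm{Lip}_0(M)$ is the Banach space of real-valued Lipschitz functions $f$ on $M$ with $f(0)=0$, normed by the best Lipschitz constant. For $x\in M$ let $\delta(x)\in\mathrm{Lip}_0(M)^*$ be $\delta(x)(f)=f(x)$. The Lipschitz-free space is $\mathcal{F}(M)=\overline{\operatorname{span}}\{\delta(x):x\in M\}\subset\mathrm{Lip}_0(M)^*$ (norm closure). A Banach space $X$ has the approximation property if for every $\varepsilon>0$ and every norm-compact set $W\subset X$ there is a finite-rank bounded linear operator $S:X\to X$ with $\|Sx-x\|\le\varepsilon$ for every $x\in W$. A metric space is scattered if it contains no nonempty perfect subset, i.e. every nonempty subset has an isolated point (in its relative topology). *)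

theory Defs
  imports "HOL-Analysis.Analysis"
begin

section \<open>The space of Lipschitz functions vanishing at the base point\<close>

text \<open>The base point is carried by the type class, so that \<open>Lip\<^sub>0(M)\<close> and \<open>F(M)\<close> become types
  and the library's normed space, dual space and compactness notions apply to them. The base point
  is an arbitrary element, unrelated to any algebraic zero of the type.\<close>

class pointed_metric_space = metric_space +
  fixes base_point :: 'a

typedef (overloaded) 'a lip0 =
  "{f :: 'a::pointed_metric_space \<Rightarrow> real. (\<exists>C. C-lipschitz_on UNIV f) \<and> f base_point = 0}"
  morphisms lip0_apply Lip0
  by (rule exI[of _ "\<lambda>_. 0"]) (auto intro: lipschitz_on_constant)

setup_lifting type_definition_lip0

lemma lip0_eqI: "(\<And>x. lip0_apply f x = lip0_apply g x) \<Longrightarrow> f = g"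
  by transfer auto

lemma lip0_apply_base_point [simp]: "lip0_apply f base_point = 0"
  by transfer auto

instantiation lip0 :: (pointed_metric_space) real_vector
begin

lift_definition zero_lip0 :: "'a lip0" is "\<lambda>_. 0"
  by (auto intro: lipschitz_on_constant)

lift_definition plus_lip0 :: "'a lip0 \<Rightarrow> 'a lip0 \<Rightarrow> 'a lip0" is "\<lambda>f g x. f x + g x"
  by (auto intro: lipschitz_on_add)

lift_definition minus_lip0 :: "'a lip0 \<Rightarrow> 'a lip0 \<Rightarrow> 'a lip0" is "\<lambda>f g x. f x - g x"
  by (auto intro: lipschitz_on_diff)

lift_definition uminus_lip0 :: "'a lip0 \<Rightarrow> 'a lip0" is "\<lambda>f x. - f x"
  by (auto intro: lipschitz_on_minus)

lift_definition scaleR_lip0 :: "real \<Rightarrow> 'a lip0 \<Rightarrow> 'a lip0" is "\<lambda>r f x. r * f x"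
  by (auto intro: lipschitz_on_cmult_real)

instance
  by standard (transfer; simp add: algebra_simps)+

end

instantiation lip0 :: (pointed_metric_space) real_normed_vector
begin

lift_definition norm_lip0 :: "'a lip0 \<Rightarrow> real"
  is "\<lambda>f. Inf {C. C-lipschitz_on UNIV f}" .

definition dist_lip0 :: "'a lip0 \<Rightarrow> 'a lip0 \<Rightarrow> real"
  where "dist_lip0 f g = norm (f - g)"

definition sgn_lip0 :: "'a lip0 \<Rightarrow> 'a lip0"
  where "sgn_lip0 f = inverse (norm f) *\<^sub>R f"

definition uniformity_lip0 :: "('a lip0 \<times> 'a lip0) filter"
  where "uniformity_lip0 = (INF e\<in>{0 <..}. principal {(f, g). dist f g < e})"

definition open_lip0 :: "'a lip0 set \<Rightarrow> bool"
  where "open_lip0 U = (\<forall>f\<in>U. \<forall>\<^sub>F (f', g) in uniformity. f' = f \<longrightarrow> g \<in> U)"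

lemma lip0_norm_le: "C-lipschitz_on UNIV (lip0_apply f) \<Longrightarrow> norm f \<le> C"
  unfolding norm_lip0.rep_eq
  by (rule cInf_lower) (auto intro!: bdd_belowI[of _ 0] lipschitz_on_nonneg)

lemma lip0_norm_lipschitz: "(norm f)-lipschitz_on UNIV (lip0_apply f)"
proof -
  let ?S = "{C. C-lipschitz_on UNIV (lip0_apply f)}"
  have ne: "?S \<noteq> {}"
    using lip0_apply[of f] by auto
  have nn: "norm f \<ge> 0"
    unfolding norm_lip0.rep_eq by (rule cInf_greatest[OF ne]) (auto intro: lipschitz_on_nonneg)
  show ?thesis
  proof (rule lipschitz_onI[OF _ nn])
    fix x y :: 'a
    show "dist (lip0_apply f x) (lip0_apply f y) \<le> norm f * dist x y"
    proof (cases "x = y")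
      case False
      then have d: "dist x y > 0" by simp
      have "dist (lip0_apply f x) (lip0_apply f y) / dist x y \<le> norm f"
        unfolding norm_lip0.rep_eq
        by (rule cInf_greatest[OF ne]) (use d in \<open>auto simp: field_simps lipschitz_on_def\<close>)
      then show ?thesis using d by (simp add: field_simps)
    qed simp
  qed
qed

instance
proof
  fix f g :: "'a lip0" and r :: real
  show "dist f g = norm (f - g)" by (rule dist_lip0_def)
  show "sgn f = f /\<^sub>R norm f" by (rule sgn_lip0_def)
  show "uniformity = (INF e\<in>{0 <..}. principal {(f, g :: 'a lip0). dist f g < e})"
    by (rule uniformity_lip0_def)
  show "open U = (\<forall>f\<in>U. \<forall>\<^sub>F (f', g) in uniformity. f' = f \<longrightarrow> g \<in> U)" for U :: "'a lip0 set"
    by (rule open_lip0_def)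
  show "norm f = 0 \<longleftrightarrow> f = 0"
  proof
    assume "norm f = 0"
    then have "lip0_apply f x = 0" for x
      using lipschitz_onD[OF lip0_norm_lipschitz, of x base_point f] by simp
    then show "f = 0" by (intro lip0_eqI) (simp add: zero_lip0.rep_eq)
  next
    assume "f = 0"
    then have "norm f \<le> 0"
      by (intro lip0_norm_le) (simp add: zero_lip0.rep_eq lipschitz_on_constant)
    then show "norm f = 0"
      using lipschitz_on_nonneg[OF lip0_norm_lipschitz[of f]] by simp
  qed
  show "norm (f + g) \<le> norm f + norm g"
    by (rule lip0_norm_le)
      (simp add: plus_lip0.rep_eq lipschitz_on_add lip0_norm_lipschitz)
  have le: "norm (r *\<^sub>R f) \<le> \<bar>r\<bar> * norm f" for r and f :: "'a lip0"
    by (rule lip0_norm_le)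
      (simp add: scaleR_lip0.rep_eq lipschitz_on_cmult_real lip0_norm_lipschitz)
  show "norm (r *\<^sub>R f) = \<bar>r\<bar> * norm f"
  proof (cases "r = 0")
    case True
    then show ?thesis
      using le[of r f] lipschitz_on_nonneg[OF lip0_norm_lipschitz[of "r *\<^sub>R f"]] by simp
  next
    case False
    then show ?thesis
      using le[of r f] le[of "inverse r" "r *\<^sub>R f"] by (simp add: field_simps)
  qed
qed

end


section \<open>The Lipschitz-free space\<close>

lift_definition delta :: "'a::pointed_metric_space \<Rightarrow> ('a lip0 \<Rightarrow>\<^sub>L real)"
  is "\<lambda>x f. lip0_apply f x"
proof (rule bounded_linear_intro)
  fix x :: 'a and f g :: "'a lip0" and r :: real
  show "lip0_apply (f + g) x = lip0_apply f x + lip0_apply g x"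
    by (simp add: plus_lip0.rep_eq)
  show "lip0_apply (r *\<^sub>R f) x = r *\<^sub>R lip0_apply f x"
    by (simp add: scaleR_lip0.rep_eq)
  show "norm (lip0_apply f x) \<le> norm f * dist x base_point"
    using lipschitz_onD[OF lip0_norm_lipschitz, of x base_point f] by simp
qed

typedef (overloaded) 'a lipschitz_free =
  "closure (span (range (delta :: 'a::pointed_metric_space \<Rightarrow> _)))"
  morphisms lipschitz_free_functional Lipschitz_free
  using closure_subset span_zero by blast

setup_lifting type_definition_lipschitz_free

lemma subspace_closure_span:
  fixes A :: "'b::real_normed_vector set"
  shows "subspace (closure (span A))"
proof (rule subspaceI)
  show "0 \<in> closure (span A)"
    using closure_subset span_zero by blast
next
  fix x y
  assume "x \<in> closure (span A)" "y \<in> closure (span A)"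
  then obtain u v where "\<forall>n. u n \<in> span A" "u \<longlonglongrightarrow> x" "\<forall>n. v n \<in> span A" "v \<longlonglongrightarrow> y"
    unfolding closure_sequential by blast
  then show "x + y \<in> closure (span A)"
    unfolding closure_sequential
    by (intro exI[of _ "\<lambda>n. u n + v n"]) (auto intro: span_add tendsto_add)
next
  fix c x
  assume "x \<in> closure (span A)"
  then obtain u where "\<forall>n. u n \<in> span A" "u \<longlonglongrightarrow> x"
    unfolding closure_sequential by blast
  then show "c *\<^sub>R x \<in> closure (span A)"
    unfolding closure_sequential
    by (intro exI[of _ "\<lambda>n. c *\<^sub>R u n"]) (auto intro: span_scale tendsto_intros)
qed

text \<open>All operations, and the norm, are those inherited from the dual space of \<open>Lip\<^sub>0(M)\<close>.\<close>

instantiation lipschitz_free :: (pointed_metric_space) real_vector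
begin

lift_definition zero_lipschitz_free :: "'a lipschitz_free" is 0
  by (rule subspace_0[OF subspace_closure_span])

lift_definition plus_lipschitz_free ::
  "'a lipschitz_free \<Rightarrow> 'a lipschitz_free \<Rightarrow> 'a lipschitz_free" is "(+)"
  by (rule subspace_add[OF subspace_closure_span])

lift_definition minus_lipschitz_free ::
  "'a lipschitz_free \<Rightarrow> 'a lipschitz_free \<Rightarrow> 'a lipschitz_free" is "(-)"
  by (rule subspace_diff[OF subspace_closure_span])

lift_definition uminus_lipschitz_free :: "'a lipschitz_free \<Rightarrow> 'a lipschitz_free" is uminus
  by (rule subspace_neg[OF subspace_closure_span])

lift_definition scaleR_lipschitz_free :: "real \<Rightarrow> 'a lipschitz_free \<Rightarrow> 'a lipschitz_free"
  is scaleR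
  by (rule subspace_scale[OF subspace_closure_span])

instance
  by standard (transfer; simp add: algebra_simps)+

end

instantiation lipschitz_free :: (pointed_metric_space) real_normed_vector
begin

lift_definition norm_lipschitz_free :: "'a lipschitz_free \<Rightarrow> real" is norm .

lift_definition dist_lipschitz_free :: "'a lipschitz_free \<Rightarrow> 'a lipschitz_free \<Rightarrow> real" is dist .

lift_definition sgn_lipschitz_free :: "'a lipschitz_free \<Rightarrow> 'a lipschitz_free" is sgn
  unfolding sgn_div_norm by (rule subspace_scale[OF subspace_closure_span])

definition uniformity_lipschitz_free :: "('a lipschitz_free \<times> 'a lipschitz_free) filter"
  where "uniformity_lipschitz_free = (INF e\<in>{0 <..}. principal {(m, n). dist m n < e})"

definition open_lipschitz_free :: "'a lipschitz_free set \<Rightarrow> bool"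
  where "open_lipschitz_free U = (\<forall>m\<in>U. \<forall>\<^sub>F (m', n) in uniformity. m' = m \<longrightarrow> n \<in> U)"

instance
proof
  fix a b :: "'a lipschitz_free" and r :: real
  show "dist a b = norm (a - b)" by transfer (rule dist_norm)
  show "sgn a = a /\<^sub>R norm a" by transfer (rule sgn_div_norm)
  show "uniformity = (INF e\<in>{0 <..}. principal {(m, n :: 'a lipschitz_free). dist m n < e})"
    by (rule uniformity_lipschitz_free_def)
  show "open U = (\<forall>m\<in>U. \<forall>\<^sub>F (m', n) in uniformity. m' = m \<longrightarrow> n \<in> U)"
    for U :: "'a lipschitz_free set"
    by (rule open_lipschitz_free_def)
  show "norm a = 0 \<longleftrightarrow> a = 0" by transfer simp
  show "norm (a + b) \<le> norm a + norm b" by transfer (rule norm_triangle_ineq)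
  show "norm (r *\<^sub>R a) = \<bar>r\<bar> * norm a" by transfer simp
qed

end

instance lipschitz_free :: (pointed_metric_space) banach
proof
  fix X :: "nat \<Rightarrow> 'a lipschitz_free"
  let ?F = "closure (span (range (delta :: 'a \<Rightarrow> _)))"
  assume "Cauchy X"
  then have "Cauchy (\<lambda>n. lipschitz_free_functional (X n))"
    unfolding Cauchy_def dist_lipschitz_free.rep_eq .
  then obtain l where l: "(\<lambda>n. lipschitz_free_functional (X n)) \<longlonglongrightarrow> l"
    using Cauchy_convergent convergent_def by blast
  have "l \<in> ?F"
    by (rule closed_sequentially[OF closed_closure _ l]) (rule lipschitz_free_functional)
  then have "lipschitz_free_functional (Lipschitz_free l) = l"
    by (rule Lipschitz_free_inverse)
  with l have "X \<longlonglongrightarrow> Lipschitz_free l"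
    unfolding tendsto_iff dist_lipschitz_free.rep_eq by simp
  then show "convergent X"
    by (rule convergentI)
qed


section \<open>Approximation property and scattered spaces\<close>

text \<open>Finite rank is expressed as the range lying in the span of a finite set, since the
  library's \<^const>\<open>dim\<close> is \<open>0\<close> on infinite-dimensional subspaces.\<close>

definition finite_rank :: "('b::real_normed_vector \<Rightarrow>\<^sub>L 'c::real_normed_vector) \<Rightarrow> bool"
  where "finite_rank S \<longleftrightarrow> (\<exists>B. finite B \<and> range (blinfun_apply S) \<subseteq> span B)"

definition approximation_property :: "'b::banach itself \<Rightarrow> bool"
  where "approximation_property _ \<longleftrightarrow>
    (\<forall>\<epsilon>>0. \<forall>W::'b set. compact W \<longrightarrow>
      (\<exists>S :: 'b \<Rightarrow>\<^sub>L 'b. finite_rank S \<and> (\<forall>x\<in>W. norm (blinfun_apply S x - x) \<le> \<epsilon>)))"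

definition scattered :: "'a::topological_space set \<Rightarrow> bool"
  where "scattered M \<longleftrightarrow> (\<forall>A\<subseteq>M. A \<noteq> {} \<longrightarrow> (\<exists>x. x isolated_in A))"

end

theory Submission
  imports Defs
begin

text \<open>On the free space a function \<open>h\<close> acts by \<open>\<delta>(q) \<mapsto> h(q)\<delta>(q)\<close>. The functions whose operator is
  approximable on compact sets by finite rank operators form an ideal. If \<open>p\<close> is such that the ideal
  contains all cutoffs supported near \<open>p\<close> but away from \<open>p\<close>, then it contains a cutoff around \<open>p\<close>:
  up to rank one, \<open>\<delta>(q) \<mapsto> h(q)\<delta>(q)\<close> is \<open>\<delta>(q) \<mapsto> h(q)(\<delta>(q) - \<delta>(p))\<close>, and there \<open>h\<close> is a limit of functions
  vanishing near \<open>p\<close> with uniformly bounded operators. On a compact set, a partition of unity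
  therefore shows that the points without such a cutoff form a set without isolated points, which
  is empty in a scattered space, so that the ideal contains \<open>1\<close>. A complete space is reduced to the
  compact case by multiplying with cutoffs around finite sets that nearly carry the given compact
  set of the free space, at scales tending to \<open>0\<close>.\<close>


section \<open>Point evaluations and Lipschitz extension\<close>

definition dirac :: "'a::pointed_metric_space \<Rightarrow> 'a lipschitz_free"
  where "dirac q = Lipschitz_free (delta q)"

lemma functional_dirac: "lipschitz_free_functional (dirac q) = delta q"
  unfolding dirac_def
  by (intro Lipschitz_free_inverse subsetD[OF closure_subset] span_base rangeI)

lemma lipschitz_free_eqI:
  "lipschitz_free_functional x = lipschitz_free_functional y \<Longrightarrow> x = y"
  by (rule lipschitz_free_functional_inject[THEN iffD1])

lemma dirac_base_point [simp]: "dirac base_point = 0"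
  by (rule lipschitz_free_eqI, rule blinfun_eqI)
    (simp add: functional_dirac zero_lipschitz_free.rep_eq delta.rep_eq)

lemma norm_dirac_diff_le: "norm (dirac p - dirac q) \<le> dist p q"
  unfolding norm_lipschitz_free.rep_eq minus_lipschitz_free.rep_eq functional_dirac
proof (rule norm_blinfun_bound)
  fix f :: "'a lip0"
  show "norm (blinfun_apply (delta p - delta q) f) \<le> dist p q * norm f"
    using lipschitz_onD[OF lip0_norm_lipschitz, of p q f]
    by (simp add: blinfun.diff_left delta.rep_eq dist_real_def mult.commute)
qed simp

lemma linear_functional: "linear lipschitz_free_functional"
  by (rule linearI) (simp_all add: plus_lipschitz_free.rep_eq scaleR_lipschitz_free.rep_eq)

text \<open>The free space is by construction the closure of the span of the evaluations in the
  dual; the linear isometry \<open>lipschitz_free_functional\<close> carries this density back. It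
  is why operators may be compared on the \<open>dirac q\<close> alone.\<close>

lemma closure_span_dirac: "closure (span (range dirac)) = (UNIV :: 'a::pointed_metric_space lipschitz_free set)"
proof -
  have "x \<in> closure (span (range dirac))" for x :: "'a lipschitz_free"
    unfolding closure_approachable
  proof (intro allI impI)
    fix e :: real assume "e > 0"
    then obtain m where m: "m \<in> span (range delta)" "dist m (lipschitz_free_functional x) < e"
      using lipschitz_free_functional[of x] unfolding closure_approachable by blast
    have "range delta = lipschitz_free_functional ` range (dirac :: 'a \<Rightarrow> _)"
      by (simp add: image_image functional_dirac)
    with m(1) have "m \<in> lipschitz_free_functional ` span (range dirac)"
      using linear_span_image[OF linear_functional, of "range dirac"] by metis
    with m(2) show "\<exists>y\<in>span (range dirac). dist y x < e"
      unfolding dist_lipschitz_free.rep_eq by blast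
  qed
  then show ?thesis by blast
qed

text \<open>The extension is the restriction to the free space of the adjoint of
  \<open>f \<mapsto> (q \<mapsto> \<langle>\<phi>(q), f\<rangle>)\<close> on \<open>Lip\<^sub>0(M)\<close>.\<close>

lemma lipschitz_extension:
  fixes \<phi> :: "'a::pointed_metric_space \<Rightarrow> 'a lipschitz_free"
  assumes lip: "C-lipschitz_on UNIV \<phi>" and base: "\<phi> base_point = 0"
  obtains T :: "'a lipschitz_free \<Rightarrow>\<^sub>L 'a lipschitz_free"
  where "norm T \<le> C" "\<And>q. blinfun_apply T (dirac q) = \<phi> q"
proof -
  define \<Phi> where "\<Phi> q = lipschitz_free_functional (\<phi> q)" for q
  let ?F = "closure (span (range (delta :: 'a \<Rightarrow> _)))"
  have C: "C \<ge> 0" using lip by (rule lipschitz_on_nonneg)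
  have \<Phi>_lip: "(C * norm f)-lipschitz_on UNIV (\<lambda>q. blinfun_apply (\<Phi> q) f)" for f
  proof (rule lipschitz_onI)
    fix p q
    have "\<bar>blinfun_apply (\<Phi> p - \<Phi> q) f\<bar> \<le> norm (\<Phi> p - \<Phi> q) * norm f"
      using norm_blinfun[of "\<Phi> p - \<Phi> q" f] by simp
    also have "\<dots> \<le> (C * dist p q) * norm f"
      using lipschitz_onD[OF lip, of p q]
      by (intro mult_right_mono) (auto simp: \<Phi>_def dist_lipschitz_free.rep_eq dist_norm)
    finally show "dist (blinfun_apply (\<Phi> p) f) (blinfun_apply (\<Phi> q) f) \<le> C * norm f * dist p q"
      by (simp add: dist_real_def blinfun.diff_left mult_ac)
  qed (use C in simp)
  have \<Phi>_base: "blinfun_apply (\<Phi> base_point) f = 0" for f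
    by (simp add: \<Phi>_def base zero_lipschitz_free.rep_eq)
  define pull where "pull f = Lip0 (\<lambda>q. blinfun_apply (\<Phi> q) f)" for f
  have pull: "lip0_apply (pull f) q = blinfun_apply (\<Phi> q) f" for f q
    unfolding pull_def using \<Phi>_lip[of f] by (subst Lip0_inverse) (auto simp: \<Phi>_base)
  have bl_pull: "bounded_linear pull"
  proof (rule bounded_linear_intro)
    show "pull (f + g) = pull f + pull g" for f g
      by (rule lip0_eqI) (simp add: pull plus_lip0.rep_eq blinfun.add_right)
    show "pull (r *\<^sub>R f) = r *\<^sub>R pull f" for r f
      by (rule lip0_eqI) (simp add: pull scaleR_lip0.rep_eq blinfun.scaleR_right)
    show "norm (pull f) \<le> norm f * C" for f
      using \<Phi>_lip[of f] by (intro lip0_norm_le) (simp add: pull mult.commute)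
  qed
  define P where "P = Blinfun pull"
  have P: "blinfun_apply P f = pull f" for f
    unfolding P_def by (simp add: bounded_linear_Blinfun_apply[OF bl_pull])
  have normP: "norm P \<le> C"
    using \<Phi>_lip by (intro norm_blinfun_bound) (auto simp: C P pull intro!: lip0_norm_le)
  define adj where "adj m = m o\<^sub>L P" for m :: "'a lip0 \<Rightarrow>\<^sub>L real"
  have lin: "linear adj"
    by (rule linearI) (auto simp: adj_def blinfun.add_left blinfun.scaleR_left intro!: blinfun_eqI)
  have norm_adj: "norm (adj m) \<le> C * norm m" for m
  proof -
    have "norm (adj m) \<le> norm m * norm P" unfolding adj_def by (rule norm_blinfun_compose)
    also have "\<dots> \<le> norm m * C" by (rule mult_left_mono[OF normP]) simp
    finally show ?thesis by (simp add: mult.commute)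
  qed
  have bl_adj: "bounded_linear adj"
    by (rule bounded_linear_intro[where K = C])
      (use lin norm_adj in \<open>auto simp: linear_add linear_scale mult.commute\<close>)
  have adj_delta: "adj (delta q) = \<Phi> q" for q
    by (rule blinfun_eqI) (simp add: adj_def delta.rep_eq P pull)
  \<comment> \<open>\<open>adj\<close> acts on the whole dual. It preserves \<open>?F\<close>
    because the preimage of \<open>?F\<close> is a closed subspace containing every
    \<open>delta q\<close>, whose image is \<open>\<Phi> q\<close>. This puts the argument of
    \<open>Lipschitz_free\<close> in the definition of \<open>t\<close> inside its domain.\<close>
  have "?F \<subseteq> adj -` ?F"
  proof (rule closure_minimal)
    show "closed (adj -` ?F)"
      by (intro continuous_closed_vimage)
        (auto intro: linear_continuous_at[OF bl_adj])
    show "span (range delta) \<subseteq> adj -` ?F"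
    proof (rule span_minimal)
      show "range delta \<subseteq> adj -` ?F"
        by (simp add: image_subset_iff adj_delta \<Phi>_def lipschitz_free_functional)
      show "subspace (adj -` ?F)"
        by (rule linear_subspace_vimage[OF lin subspace_closure_span])
    qed
  qed
  then have adjF: "adj (lipschitz_free_functional x) \<in> ?F" for x
    using lipschitz_free_functional[of x] by blast
  define t where "t x = Lipschitz_free (adj (lipschitz_free_functional x))" for x
  have t: "lipschitz_free_functional (t x) = adj (lipschitz_free_functional x)" for x
    unfolding t_def by (rule Lipschitz_free_inverse[OF adjF])
  have bl_t: "bounded_linear t"
  proof (rule bounded_linear_intro[where K = C])
    show "t (x + y) = t x + t y" for x y
      by (rule lipschitz_free_eqI) (simp add: t linear_add[OF lin] plus_lipschitz_free.rep_eq)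
    show "t (r *\<^sub>R x) = r *\<^sub>R t x" for r x
      by (rule lipschitz_free_eqI) (simp add: t linear_scale[OF lin] scaleR_lipschitz_free.rep_eq)
    show "norm (t x) \<le> norm x * C" for x
      using norm_adj by (simp add: t norm_lipschitz_free.rep_eq mult.commute)
  qed
  show thesis
  proof (rule that[of "Blinfun t"])
    show "norm (Blinfun t) \<le> C"
      using norm_adj
      by (intro norm_blinfun_bound C)
        (simp add: t bounded_linear_Blinfun_apply[OF bl_t] norm_lipschitz_free.rep_eq)
    show "blinfun_apply (Blinfun t) (dirac q) = \<phi> q" for q
      by (rule lipschitz_free_eqI)
        (simp add: bounded_linear_Blinfun_apply[OF bl_t] t functional_dirac adj_delta \<Phi>_def)
  qed
qed

section \<open>Bounded operators on closed spans\<close>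

lemma blinfun_eq_on_closure_span:
  fixes S T :: "'b::real_normed_vector \<Rightarrow>\<^sub>L 'c::real_normed_vector"
  assumes "\<And>b. b \<in> B \<Longrightarrow> blinfun_apply S b = blinfun_apply T b" "x \<in> closure (span B)"
  shows "blinfun_apply S x = blinfun_apply T x"
proof -
  have "closure (span B) \<subseteq> {x. blinfun_apply (S - T) x = 0}"
  proof (rule closure_minimal)
    show "closed {x. blinfun_apply (S - T) x = 0}"
      by (intro closed_Collect_eq continuous_intros)
    show "span B \<subseteq> {x. blinfun_apply (S - T) x = 0}"
      using assms(1)
      by (intro span_minimal subspaceI)
        (auto simp: blinfun.diff_left blinfun.add_right blinfun.scaleR_right)
  qed
  with assms(2) show ?thesis by (auto simp: blinfun.diff_left)
qed

lemma lipschitz_free_blinfun_eqI: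
  fixes S T :: "'a::pointed_metric_space lipschitz_free \<Rightarrow>\<^sub>L 'b::real_normed_vector"
  assumes "\<And>q. blinfun_apply S (dirac q) = blinfun_apply T (dirac q)"
  shows "S = T"
  by (rule blinfun_eqI, rule blinfun_eq_on_closure_span[of "range dirac"])
    (auto simp: assms closure_span_dirac)

text \<open>The preimage of a closed subspace under a bounded operator is a closed subspace. This
  serves both for supports and for invariant subspaces of weighted operators.\<close>

lemma blinfun_image_closure_span:
  fixes T :: "'b::real_normed_vector \<Rightarrow>\<^sub>L 'c::real_normed_vector"
  assumes "blinfun_apply T ` B \<subseteq> closure (span D)" "x \<in> closure (span B)"
  shows "blinfun_apply T x \<in> closure (span D)"
proof -
  have "closure (span B) \<subseteq> blinfun_apply T -` closure (span D)"
  proof (rule closure_minimal)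
    show "closed (blinfun_apply T -` closure (span D))"
      by (intro continuous_closed_vimage closed_closure)
        (auto intro: linear_continuous_at blinfun.bounded_linear_right)
    show "span B \<subseteq> blinfun_apply T -` closure (span D)"
      using assms(1)
      by (intro span_minimal linear_subspace_vimage subspace_closure_span
          bounded_linear.linear blinfun.bounded_linear_right) auto
  qed
  with assms(2) show ?thesis by blast
qed


section \<open>Uniform convergence on compact sets\<close>

text \<open>The common norm bound makes the \<open>T k\<close> equicontinuous, so convergence has to
  be controlled only at finitely many points of the dense span, chosen near a finite net of
  \<open>W\<close>.\<close>

lemma uniform_on_compact:
  fixes T :: "nat \<Rightarrow> 'b::real_normed_vector \<Rightarrow>\<^sub>L 'c::real_normed_vector"
  assumes "compact W" and C: "\<And>k. norm (T k) \<le> C"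
    and dense: "closure (span B) = UNIV"
    and lim: "\<And>b. b \<in> B \<Longrightarrow> (\<lambda>k. blinfun_apply (T k) b) \<longlonglongrightarrow> blinfun_apply S b"
    and "\<epsilon> > 0"
  shows "\<forall>\<^sub>F k in sequentially. \<forall>x\<in>W. norm (blinfun_apply (T k) x - blinfun_apply S x) < \<epsilon>"
proof -
  define D where "D = C + norm S + 1"
  have "0 \<le> C" using C[of 0] norm_ge_zero[of "T 0"] by linarith
  then have D: "D > 0" unfolding D_def by (smt (verit) norm_ge_zero)
  have bound: "norm (blinfun_apply (T k - S) x) \<le> D * norm x" for k x
  proof -
    have "norm (T k - S) \<le> D"
      using norm_triangle_ineq4[of "T k" S] C[of k] by (simp add: D_def)
    then show ?thesis
      using norm_blinfun[of "T k - S" x] mult_right_mono[of _ D "norm x"]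
      by (meson norm_ge_zero order_trans)
  qed
  \<comment> \<open>Each point of \<open>W\<close> is within \<open>2 * e\<close> of a chosen point
    of the span; moving there costs \<open>D * (2 * e)\<close>, two thirds of
    \<open>\<epsilon>\<close>. The last third is the error at that point.\<close>
  define e where "e = \<epsilon> / (3 * D)"
  have e: "e > 0" using \<open>\<epsilon> > 0\<close> D by (simp add: e_def)
  obtain N where N: "finite N" "W \<subseteq> (\<Union>x\<in>N. ball x e)"
    using \<open>compact W\<close> e unfolding compact_eq_totally_bounded by blast
  have conv_span: "(\<lambda>k. blinfun_apply (T k) z) \<longlonglongrightarrow> blinfun_apply S z" if "z \<in> span B" for z
    using that
  proof (induction rule: span_induct_alt)
    case base
    then show ?case by simp
  next
    case (step c b z)
    then show ?case
      by (auto simp: blinfun.add_right blinfun.scaleR_right intro!: tendsto_intros lim)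
  qed
  have "\<exists>z\<in>span B. dist z x < e" for x
    using e dense unfolding closure_approachable set_eq_iff by blast
  then obtain z where z: "\<And>x. z x \<in> span B" "\<And>x. dist (z x) x < e"
    by metis
  have "\<forall>\<^sub>F k in sequentially. \<forall>x\<in>N. dist (blinfun_apply (T k) (z x)) (blinfun_apply S (z x)) < \<epsilon> / 3"
    using \<open>\<epsilon> > 0\<close> by (intro eventually_ball_finite N ballI tendstoD conv_span z) auto
  then show ?thesis
  proof eventually_elim
    case (elim k)
    show ?case
    proof
      fix x assume "x \<in> W"
      then obtain y where y: "y \<in> N" "dist y x < e" using N by auto
      have "blinfun_apply (T k) x - blinfun_apply S x
          = blinfun_apply (T k - S) (x - z y) + (blinfun_apply (T k) (z y) - blinfun_apply S (z y))"
        by (simp add: blinfun.diff_left blinfun.diff_right)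
      also have "norm \<dots> \<le> D * norm (x - z y) + norm (blinfun_apply (T k) (z y) - blinfun_apply S (z y))"
        using norm_triangle_ineq bound by (smt (verit))
      also have "\<dots> < D * (2 * e) + \<epsilon> / 3"
      proof (rule add_strict_mono)
        have "norm (x - z y) < 2 * e"
          using y z(2)[of y] dist_triangle[of x "z y" y] by (simp add: dist_commute dist_norm)
        then show "D * norm (x - z y) < D * (2 * e)" using D by simp
        show "norm (blinfun_apply (T k) (z y) - blinfun_apply S (z y)) < \<epsilon> / 3"
          using elim y by (simp add: dist_norm)
      qed
      also have "D * (2 * e) + \<epsilon> / 3 = \<epsilon>" using D by (simp add: e_def)
      finally show "norm (blinfun_apply (T k) x - blinfun_apply S x) < \<epsilon>" .
    qed
  qed
qed

section \<open>Finite rank operators and approximability on a subset\<close>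

lemma finite_rank_compose_left: "finite_rank S \<Longrightarrow> finite_rank (S o\<^sub>L T)"
  unfolding finite_rank_def by auto

lemma finite_rank_add:
  assumes "finite_rank S" "finite_rank T"
  shows "finite_rank (S + T)"
proof -
  obtain B C where "finite B" "range (blinfun_apply S) \<subseteq> span B"
    and "finite C" "range (blinfun_apply T) \<subseteq> span C"
    using assms unfolding finite_rank_def by blast
  then have "finite (B \<union> C)" "range (blinfun_apply (S + T)) \<subseteq> span (B \<union> C)"
    by (fastforce simp: blinfun.add_left span_Un image_subset_iff)+
  then show ?thesis unfolding finite_rank_def by blast
qed

lemma finite_rank_uminus: "finite_rank S \<Longrightarrow> finite_rank (- S)"
  unfolding finite_rank_def by (simp add: blinfun.minus_left image_subset_iff) (metis span_neg)

text \<open>The approximation property is the case \<open>Y = UNIV\<close>,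
  \<open>T = id_blinfun\<close>. The parameter \<open>Y\<close> will be \<open>limit_space\<close>,
  on which a weight may be altered off any \<open>K j\<close>; the approximants act on the whole
  space and need not preserve \<open>Y\<close>.\<close>

definition approximable_on :: "'b::real_normed_vector set \<Rightarrow> ('b \<Rightarrow>\<^sub>L 'b) \<Rightarrow> bool"
  where "approximable_on Y T \<longleftrightarrow> (\<forall>\<epsilon>>0. \<forall>W\<subseteq>Y. compact W \<longrightarrow>
    (\<exists>S. finite_rank S \<and> (\<forall>x\<in>W. norm (blinfun_apply S x - blinfun_apply T x) \<le> \<epsilon>)))"

lemma approximable_onD:
  assumes "approximable_on Y T" "compact W" "W \<subseteq> Y" "\<epsilon> > 0"
  shows "\<exists>S. finite_rank S \<and> (\<forall>x\<in>W. norm (blinfun_apply S x - blinfun_apply T x) \<le> \<epsilon>)"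
  using assms unfolding approximable_on_def by blast

lemma approximable_on_finite_rank: "finite_rank T \<Longrightarrow> approximable_on Y T"
  unfolding approximable_on_def by (intro allI impI exI[of _ T]) auto

lemma approximable_on_add:
  assumes "approximable_on Y S" "approximable_on Y T"
  shows "approximable_on Y (S + T)"
  unfolding approximable_on_def
proof (intro allI impI)
  fix \<epsilon> :: real and W :: "'a set" assume W: "\<epsilon> > 0" "W \<subseteq> Y" "compact W"
  obtain S' where S': "finite_rank S'" "\<And>x. x \<in> W \<Longrightarrow> norm (blinfun_apply S' x - blinfun_apply S x) \<le> \<epsilon> / 2"
    using approximable_onD[OF assms(1) W(3,2) half_gt_zero[OF W(1)]] by blast
  obtain T' where T': "finite_rank T'" "\<And>x. x \<in> W \<Longrightarrow> norm (blinfun_apply T' x - blinfun_apply T x) \<le> \<epsilon> / 2"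
    using approximable_onD[OF assms(2) W(3,2) half_gt_zero[OF W(1)]] by blast
  have "norm (blinfun_apply (S' + T') x - blinfun_apply (S + T) x) \<le> \<epsilon>" if "x \<in> W" for x
    using S'(2)[OF that] T'(2)[OF that]
      norm_diff_triangle_ineq[of "blinfun_apply S' x" "blinfun_apply T' x" "blinfun_apply S x" "blinfun_apply T x"]
    by (simp add: blinfun.add_left)
  then show "\<exists>R. finite_rank R \<and> (\<forall>x\<in>W. norm (blinfun_apply R x - blinfun_apply (S + T) x) \<le> \<epsilon>)"
    using finite_rank_add[OF S'(1) T'(1)] by blast
qed

lemma approximable_on_uminus:
  assumes "approximable_on Y T"
  shows "approximable_on Y (- T)"
  unfolding approximable_on_def
proof (intro allI impI)
  fix \<epsilon> :: real and W :: "'a set" assume W: "\<epsilon> > 0" "W \<subseteq> Y" "compact W"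
  obtain S where S: "finite_rank S" "\<And>x. x \<in> W \<Longrightarrow> norm (blinfun_apply S x - blinfun_apply T x) \<le> \<epsilon>"
    using approximable_onD[OF assms W(3,2,1)] by blast
  then show "\<exists>R. finite_rank R \<and> (\<forall>x\<in>W. norm (blinfun_apply R x - blinfun_apply (- T) x) \<le> \<epsilon>)"
    by (intro exI[of _ "- S"]) (auto simp: finite_rank_uminus blinfun.minus_left norm_minus_commute)
qed

lemma approximable_on_diff:
  "approximable_on Y S \<Longrightarrow> approximable_on Y T \<Longrightarrow> approximable_on Y (S - T)"
  using approximable_on_add[of Y S "- T"] approximable_on_uminus[of Y T] by simp

text \<open>\<open>U\<close> maps compact subsets of \<open>Y\<close> to compact subsets of
  \<open>Y\<close>. This is the ideal property: weighted operators leave \<open>limit_space\<close>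
  invariant.\<close>

lemma approximable_on_compose:
  assumes T: "approximable_on Y T" and U: "blinfun_apply U ` Y \<subseteq> Y"
  shows "approximable_on Y (T o\<^sub>L U)"
  unfolding approximable_on_def
proof (intro allI impI)
  fix \<epsilon> :: real and W :: "'a set" assume W: "\<epsilon> > 0" "W \<subseteq> Y" "compact W"
  have "compact (blinfun_apply U ` W)"
    by (intro compact_continuous_image W continuous_intros)
  then obtain S where "finite_rank S"
    "\<forall>x\<in>blinfun_apply U ` W. norm (blinfun_apply S x - blinfun_apply T x) \<le> \<epsilon>"
    using approximable_onD[OF T _ _ W(1), of "blinfun_apply U ` W"] U W(2) by blast
  then show "\<exists>R. finite_rank R \<and> (\<forall>x\<in>W. norm (blinfun_apply R x - blinfun_apply (T o\<^sub>L U) x) \<le> \<epsilon>)"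
    by (intro exI[of _ "S o\<^sub>L U"]) (auto simp: finite_rank_compose_left)
qed

lemma approximable_on_cong:
  assumes "approximable_on Y S" "\<And>x. x \<in> Y \<Longrightarrow> blinfun_apply S x = blinfun_apply T x"
  shows "approximable_on Y T"
  unfolding approximable_on_def
proof (intro allI impI)
  fix \<epsilon> :: real and W :: "'a set" assume W: "\<epsilon> > 0" "W \<subseteq> Y" "compact W"
  show "\<exists>R. finite_rank R \<and> (\<forall>x\<in>W. norm (blinfun_apply R x - blinfun_apply T x) \<le> \<epsilon>)"
    using approximable_onD[OF assms(1) W(3,2,1)] assms(2) W(2) by (auto simp: subset_iff)
qed

text \<open>Convergence is asked for only on a generating set; the norm bound makes it uniform on
  each compact \<open>W\<close>, so one \<open>T k\<close> already serves.\<close>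

lemma approximable_on_limit:
  fixes T :: "nat \<Rightarrow> 'a::real_normed_vector \<Rightarrow>\<^sub>L 'a"
  assumes T: "\<And>k. approximable_on Y (T k)" "\<And>k. norm (T k) \<le> C"
    and "closure (span B) = UNIV"
    and "\<And>b. b \<in> B \<Longrightarrow> (\<lambda>k. blinfun_apply (T k) b) \<longlonglongrightarrow> blinfun_apply S b"
  shows "approximable_on Y S"
  unfolding approximable_on_def
proof (intro allI impI)
  fix \<epsilon> :: real and W :: "'a set" assume W: "\<epsilon> > 0" "W \<subseteq> Y" "compact W"
  then obtain k where k: "\<forall>x\<in>W. norm (blinfun_apply (T k) x - blinfun_apply S x) < \<epsilon> / 2"
    using eventually_happens[OF uniform_on_compact[OF W(3) assms(2-4), of "\<epsilon> / 2"]] by auto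
  obtain R where R: "finite_rank R" "\<And>x. x \<in> W \<Longrightarrow> norm (blinfun_apply R x - blinfun_apply (T k) x) \<le> \<epsilon> / 2"
    using approximable_onD[OF T(1) W(3,2) half_gt_zero[OF W(1)]] by blast
  have "norm (blinfun_apply R x - blinfun_apply S x) \<le> \<epsilon>" if "x \<in> W" for x
    using norm_diff_triangle_le[OF R(2)[OF that] less_imp_le[OF k[rule_format, OF that]]] by simp
  with R(1) show "\<exists>R. finite_rank R \<and> (\<forall>x\<in>W. norm (blinfun_apply R x - blinfun_apply S x) \<le> \<epsilon>)"
    by blast
qed

section \<open>Weighted point evaluations\<close>

text \<open>Such a \<open>T\<close> is the predual of the multiplication by \<open>h\<close> on
  \<open>Lip_0(M)\<close>.\<close>

definition weightable :: "('a::pointed_metric_space \<Rightarrow> real) \<Rightarrow> bool"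
  where "weightable h \<longleftrightarrow>
    (\<exists>T :: 'a lipschitz_free \<Rightarrow>\<^sub>L 'a lipschitz_free. \<forall>q. blinfun_apply T (dirac q) = h q *\<^sub>R dirac q)"

text \<open>Evaluations span a dense subspace, so at most one operator is eligible; if
  \<open>h\<close> is not weightable the value is arbitrary.\<close>

definition weight_op ::
    "('a::pointed_metric_space \<Rightarrow> real) \<Rightarrow> 'a lipschitz_free \<Rightarrow>\<^sub>L 'a lipschitz_free"
  where "weight_op h = (SOME T. \<forall>q. blinfun_apply T (dirac q) = h q *\<^sub>R dirac q)"

lemma weight_op_dirac: "weightable h \<Longrightarrow> blinfun_apply (weight_op h) (dirac q) = h q *\<^sub>R dirac q"
  unfolding weightable_def weight_op_def by (rule someI2_ex) auto

lemma
  assumes "\<And>q. blinfun_apply T (dirac q) = h q *\<^sub>R dirac q"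
  shows weightableI: "weightable h" and weight_op_eqI: "weight_op h = T"
proof -
  show "weightable h" unfolding weightable_def using assms by blast
  then show "weight_op h = T"
    by (intro lipschitz_free_blinfun_eqI) (simp add: weight_op_dirac assms)
qed

lemma
  assumes "weightable g" "weightable h"
  shows weightable_add: "weightable (\<lambda>q. g q + h q)"
    and weight_op_add: "weight_op (\<lambda>q. g q + h q) = weight_op g + weight_op h"
    and weightable_diff: "weightable (\<lambda>q. g q - h q)"
    and weight_op_diff: "weight_op (\<lambda>q. g q - h q) = weight_op g - weight_op h"
    and weightable_mult: "weightable (\<lambda>q. g q * h q)"
    and weight_op_mult: "weight_op (\<lambda>q. g q * h q) = weight_op g o\<^sub>L weight_op h"
proof -
  have "blinfun_apply (weight_op g + weight_op h) (dirac q) = (g q + h q) *\<^sub>R dirac q"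
    and "blinfun_apply (weight_op g - weight_op h) (dirac q) = (g q - h q) *\<^sub>R dirac q"
    and "blinfun_apply (weight_op g o\<^sub>L weight_op h) (dirac q) = (g q * h q) *\<^sub>R dirac q" for q
    by (simp_all add: weight_op_dirac assms blinfun.add_left blinfun.diff_left
        blinfun.scaleR_right algebra_simps)
  note * = weightableI[OF this(1)] weight_op_eqI[OF this(1)] weightableI[OF this(2)]
    weight_op_eqI[OF this(2)] weightableI[OF this(3)] weight_op_eqI[OF this(3)]
  show "weightable (\<lambda>q. g q + h q)" "weight_op (\<lambda>q. g q + h q) = weight_op g + weight_op h"
    "weightable (\<lambda>q. g q - h q)" "weight_op (\<lambda>q. g q - h q) = weight_op g - weight_op h"
    "weightable (\<lambda>q. g q * h q)" "weight_op (\<lambda>q. g q * h q) = weight_op g o\<^sub>L weight_op h"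
    by (rule *)+
qed

lemma
  shows weightable_const: "weightable (\<lambda>_. c)"
    and weight_op_const: "weight_op (\<lambda>_. c) = c *\<^sub>R id_blinfun"
  by (rule weightableI[of "c *\<^sub>R id_blinfun"] weight_op_eqI; simp add: blinfun.scaleR_left)+

lemma weight_op_supported:
  assumes "weightable h" "\<And>q. q \<notin> D \<Longrightarrow> h q = 0"
  shows "blinfun_apply (weight_op h) x \<in> closure (span (dirac ` D))"
proof (rule blinfun_image_closure_span[where B = "range dirac"])
  have "h q *\<^sub>R dirac q \<in> span (dirac ` D)" for q
    using assms(2)[of q] by (cases "q \<in> D") (auto intro: span_scale span_base simp: span_zero)
  then show "blinfun_apply (weight_op h) ` range dirac \<subseteq> closure (span (dirac ` D))"
    using closure_subset by (fastforce simp: weight_op_dirac assms(1))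
qed (simp add: closure_span_dirac)

lemma weight_op_invariant:
  assumes "weightable h" "x \<in> closure (span (dirac ` D))"
  shows "blinfun_apply (weight_op h) x \<in> closure (span (dirac ` D))"
proof (rule blinfun_image_closure_span[OF _ assms(2)])
  have "h q *\<^sub>R dirac q \<in> span (dirac ` D)" if "q \<in> D" for q
    using that by (intro span_scale span_base imageI)
  then show "blinfun_apply (weight_op h) ` dirac ` D \<subseteq> closure (span (dirac ` D))"
    using closure_subset by (fastforce simp: weight_op_dirac assms(1))
qed

lemma weight_op_cong_on:
  assumes "weightable g" "weightable h" "\<And>q. q \<in> D \<Longrightarrow> g q = h q" "x \<in> closure (span (dirac ` D))"
  shows "blinfun_apply (weight_op g) x = blinfun_apply (weight_op h) x"
  by (rule blinfun_eq_on_closure_span[OF _ assms(4)]) (auto simp: weight_op_dirac assms(1-3))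

text \<open>A radial bound at \<open>p\<close> is what makes \<open>q \<mapsto> h(q)(\<delta>(q) - \<delta>(p))\<close> Lipschitz. It tolerates slopes
  of order \<open>1 / d(q, p)\<close>, hence holds uniformly for cutoffs around \<open>p\<close> at every scale.\<close>

definition radial :: "'a::metric_space \<Rightarrow> real \<Rightarrow> ('a \<Rightarrow> real) \<Rightarrow> bool"
  where "radial p C h \<longleftrightarrow>
    (\<forall>q q'. dist q' p \<le> dist q p \<longrightarrow> \<bar>h q - h q'\<bar> * dist q' p \<le> C * dist q q')"

lemma radialD: "radial p C h \<Longrightarrow> dist q' p \<le> dist q p \<Longrightarrow> \<bar>h q - h q'\<bar> * dist q' p \<le> C * dist q q'"
  unfolding radial_def by blast

lemma lipschitz_on_weighted_dirac:
  assumes B: "\<And>q. \<bar>h q\<bar> \<le> B" and C: "radial p C h" "0 \<le> C"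
  shows "(B + C)-lipschitz_on UNIV (\<lambda>q. h q *\<^sub>R (dirac q - dirac p))"
proof (rule lipschitz_onI)
  have *: "dist (h q *\<^sub>R (dirac q - dirac p)) (h q' *\<^sub>R (dirac q' - dirac p)) \<le> (B + C) * dist q q'"
    if le: "dist q' p \<le> dist q p" for q q'
  proof -
    \<comment> \<open>With \<open>q'\<close> the point nearer to \<open>p\<close>, the increment of
      \<open>h\<close> meets a vector of norm at most \<open>dist q' p\<close>, which is the product
      that \<open>radial\<close> bounds.\<close>
    have "h q *\<^sub>R (dirac q - dirac p) - h q' *\<^sub>R (dirac q' - dirac p)
        = h q *\<^sub>R (dirac q - dirac q') + (h q - h q') *\<^sub>R (dirac q' - dirac p)"
      by (simp add: algebra_simps)
    also have "norm \<dots> \<le> \<bar>h q\<bar> * norm (dirac q - dirac q') + \<bar>h q - h q'\<bar> * norm (dirac q' - dirac p)"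
      by (rule order_trans[OF norm_triangle_ineq]) simp
    also have "\<dots> \<le> B * dist q q' + \<bar>h q - h q'\<bar> * dist q' p"
      using B[of q] by (intro add_mono mult_mono norm_dirac_diff_le) auto
    also have "\<dots> \<le> B * dist q q' + C * dist q q'"
      using radialD[OF C(1) le] by simp
    finally show ?thesis by (simp add: dist_norm algebra_simps)
  qed
  fix q q' :: 'a
  show "dist (h q *\<^sub>R (dirac q - dirac p)) (h q' *\<^sub>R (dirac q' - dirac p)) \<le> (B + C) * dist q q'"
    using *[of q' q] *[of q q'] by (cases "dist q' p \<le> dist q p") (auto simp: dist_commute)
  show "0 \<le> B + C" using B[of p] C(2) by linarith
qed

text \<open>Either the nearer point lies outside the ball and both values vanish, or its distance to
  \<open>p\<close> is below \<open>\<rho>\<close> and the Lipschitz estimate suffices.\<close>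

lemma radial_if_bounded_support:
  assumes lip: "L-lipschitz_on UNIV h" and supp: "\<And>q. \<rho> \<le> dist q p \<Longrightarrow> h q = 0" and "0 \<le> \<rho>"
  shows "radial p (L * \<rho>) h"
  unfolding radial_def
proof (intro allI impI)
  fix q q' assume le: "dist q' p \<le> dist q p"
  show "\<bar>h q - h q'\<bar> * dist q' p \<le> L * \<rho> * dist q q'"
  proof (cases "\<rho> \<le> dist q' p")
    case True
    then show ?thesis using supp le lipschitz_on_nonneg[OF lip] \<open>0 \<le> \<rho>\<close> by simp
  next
    case False
    have "\<bar>h q - h q'\<bar> * dist q' p \<le> (L * dist q q') * \<rho>"
      using lipschitz_onD[OF lip, of q q'] False
      by (intro mult_mono) (auto simp: dist_real_def)
    then show ?thesis by (simp add: mult_ac)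
  qed
qed

text \<open>At the base point \<open>dirac p\<close> is \<open>0\<close>, so the Lipschitz map above
  is \<open>q \<mapsto> h q *\<^sub>R dirac q\<close> itself, and its extension is the
  operator.\<close>

lemma
  assumes B: "\<And>q. \<bar>h q\<bar> \<le> B" and C: "radial base_point C h" "0 \<le> C"
  shows weightable_radial: "weightable h" and norm_weight_op_radial: "norm (weight_op h) \<le> B + C"
proof -
  have "(B + C)-lipschitz_on UNIV (\<lambda>q. h q *\<^sub>R dirac q)"
    using lipschitz_on_weighted_dirac[OF assms] by simp
  then obtain T where T: "norm T \<le> B + C" "\<And>q. blinfun_apply T (dirac q) = h q *\<^sub>R dirac q"
    by (rule lipschitz_extension) auto
  show "weightable h" by (rule weightableI[OF T(2)])
  show "norm (weight_op h) \<le> B + C" using T(1) weight_op_eqI[OF T(2)] by simp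
qed

section \<open>Cutoff functions\<close>

definition cutoff :: "'a::metric_space set \<Rightarrow> real \<Rightarrow> 'a \<Rightarrow> real"
  where "cutoff A r q = max 0 (min 1 (2 - infdist q A / r))"

lemma cutoff_nonneg: "0 \<le> cutoff A r q" and cutoff_le_1: "cutoff A r q \<le> 1"
  and abs_cutoff_le_1: "\<bar>cutoff A r q\<bar> \<le> 1"
  by (simp_all add: cutoff_def)

lemma cutoff_eq_1: "r > 0 \<Longrightarrow> infdist q A \<le> r \<Longrightarrow> cutoff A r q = 1"
  by (simp add: cutoff_def)

lemma cutoff_eq_0: "r > 0 \<Longrightarrow> 2 * r \<le> infdist q A \<Longrightarrow> cutoff A r q = 0"
  by (simp add: cutoff_def field_simps)

lemma cutoff_lipschitz:
  assumes "r > 0"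
  shows "(1 / r)-lipschitz_on UNIV (cutoff A r)"
proof (rule lipschitz_onI)
  fix q q' :: 'a
  have "\<bar>cutoff A r q - cutoff A r q'\<bar> \<le> \<bar>infdist q A / r - infdist q' A / r\<bar>"
    by (simp add: cutoff_def max_def min_def abs_minus_commute)
  also have "\<dots> = \<bar>infdist q A - infdist q' A\<bar> / r"
    using assms by (simp add: diff_divide_distrib[symmetric])
  also have "\<dots> \<le> dist q q' / r"
    using assms infdist_triangle_abs by (intro divide_right_mono) auto
  finally show "dist (cutoff A r q) (cutoff A r q') \<le> 1 / r * dist q q'"
    by (simp add: dist_real_def)
qed (use assms in simp)

text \<open>Slope \<open>1 / r\<close> and support radius \<open>2 * r\<close> compensate each
  other, so the constant is the same at every scale. This bounds both the cutoffs shrinking to a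
  point and those growing around the base point.\<close>

lemma radial_cutoff: "r > 0 \<Longrightarrow> radial p 2 (cutoff {p} r)"
  using radial_if_bounded_support[OF cutoff_lipschitz[of r "{p}"], of "2 * r" p]
  by (simp add: cutoff_eq_0)

lemma weightable_cutoff:
  fixes p :: "'a::pointed_metric_space"
  assumes "r > 0"
  shows "weightable (cutoff {p} r)"
proof (rule weightable_radial[OF abs_cutoff_le_1])
  \<comment> \<open>The ball of this radius around the base point contains the support. The
    resulting constant is not uniform: for \<open>p\<close> other than the base point it blows up as
    \<open>r\<close> tends to 0.\<close>
  let ?\<rho> = "2 * r + dist p base_point"
  show "radial base_point (1 / r * ?\<rho>) (cutoff {p} r)"
  proof (rule radial_if_bounded_support[OF cutoff_lipschitz[OF assms]])
    fix q :: 'a assume "?\<rho> \<le> dist q base_point"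
    then have "2 * r \<le> dist q p" using dist_triangle[of q base_point p] by linarith
    then show "cutoff {p} r q = 0" using assms by (simp add: cutoff_eq_0)
  qed (use assms in simp)
qed (use assms in simp)

lemma radial_mult:
  assumes g: "radial p C g" "\<And>q. \<bar>g q\<bar> \<le> 1" and h: "radial p D h" "\<And>q. \<bar>h q\<bar> \<le> 1"
  shows "radial p (C + D) (\<lambda>q. g q * h q)"
  unfolding radial_def
proof (intro allI impI)
  fix q q' assume le: "dist q' p \<le> dist q p"
  have "g q * h q - g q' * h q' = (g q - g q') * h q + g q' * (h q - h q')"
    by (simp add: algebra_simps)
  also have "\<bar>\<dots>\<bar> \<le> \<bar>g q - g q'\<bar> * \<bar>h q\<bar> + \<bar>g q'\<bar> * \<bar>h q - h q'\<bar>"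
    by (rule order_trans[OF abs_triangle_ineq]) (simp add: abs_mult)
  also have "\<dots> \<le> \<bar>g q - g q'\<bar> * 1 + 1 * \<bar>h q - h q'\<bar>"
    by (intro add_mono mult_mono g h) auto
  finally have "\<bar>g q * h q - g q' * h q'\<bar> * dist q' p
      \<le> (\<bar>g q - g q'\<bar> * 1 + 1 * \<bar>h q - h q'\<bar>) * dist q' p"
    by (rule mult_right_mono) simp
  also have "\<dots> \<le> (C + D) * dist q q'"
    using radialD[OF g(1) le] radialD[OF h(1) le] by (simp add: algebra_simps)
  finally show "\<bar>g q * h q - g q' * h q'\<bar> * dist q' p \<le> (C + D) * dist q q'" .
qed

lemma lipschitz_on_mult_bounded:
  fixes f g :: "'a::metric_space \<Rightarrow> real"
  assumes f: "C-lipschitz_on U f" "\<And>x. x \<in> U \<Longrightarrow> \<bar>f x\<bar> \<le> A"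
    and g: "D-lipschitz_on U g" "\<And>x. x \<in> U \<Longrightarrow> \<bar>g x\<bar> \<le> B" and "0 \<le> A" "0 \<le> B"
  shows "(A * D + B * C)-lipschitz_on U (\<lambda>x. f x * g x)"
proof (rule lipschitz_onI)
  fix x y assume x: "x \<in> U" and y: "y \<in> U"
  have "\<bar>f x * g x - f y * g y\<bar> = \<bar>f x * (g x - g y) + g y * (f x - f y)\<bar>"
    by (simp add: algebra_simps)
  also have "\<dots> \<le> \<bar>f x\<bar> * \<bar>g x - g y\<bar> + \<bar>g y\<bar> * \<bar>f x - f y\<bar>"
    by (rule order_trans[OF abs_triangle_ineq]) (simp add: abs_mult)
  also have "\<dots> \<le> A * (D * dist x y) + B * (C * dist x y)"
    using lipschitz_onD[OF f(1) x y] lipschitz_onD[OF g(1) x y] assms(5,6)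
    by (intro add_mono mult_mono f g x y) (auto simp: dist_real_def)
  finally show "dist (f x * g x) (f y * g y) \<le> (A * D + B * C) * dist x y"
    by (simp add: dist_real_def algebra_simps)
qed (use assms(5,6) lipschitz_on_nonneg[OF f(1)] lipschitz_on_nonneg[OF g(1)] in simp)

text \<open>Subtracting its value at the base point puts \<open>h\<close> into
  \<open>Lip_0(M)\<close>, hence makes it a functional on the free space, which is then multiplied
  by \<open>v\<close>.\<close>

lemma rank_one_operator:
  fixes h :: "'a::pointed_metric_space \<Rightarrow> real" and v :: "'a lipschitz_free"
  assumes "L-lipschitz_on UNIV h"
  obtains E where "finite_rank E" "\<And>q. blinfun_apply E (dirac q) = (h q - h base_point) *\<^sub>R v"
proof -
  define f where "f = Lip0 (\<lambda>q. h q - h base_point)"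
  have "(L + 0)-lipschitz_on UNIV (\<lambda>q. h q - h base_point)"
    by (rule lipschitz_on_diff[OF assms lipschitz_on_constant])
  then have f: "lip0_apply f q = h q - h base_point" for q
    unfolding f_def by (subst Lip0_inverse) auto
  define e where "e x = blinfun_apply (lipschitz_free_functional x) f *\<^sub>R v" for x
  have "bounded_linear e"
  proof (rule bounded_linear_intro[where K = "norm f * norm v"])
    show "e (x + y) = e x + e y" for x y
      by (simp add: e_def plus_lipschitz_free.rep_eq blinfun.add_left scaleR_left_distrib)
    show "e (r *\<^sub>R x) = r *\<^sub>R e x" for r x
      by (simp add: e_def scaleR_lipschitz_free.rep_eq blinfun.scaleR_left)
    show "norm (e x) \<le> norm x * (norm f * norm v)" for x
    proof -
      have "norm (blinfun_apply (lipschitz_free_functional x) f) \<le> norm x * norm f"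
        unfolding norm_lipschitz_free.rep_eq by (rule norm_blinfun)
      from mult_right_mono[OF this, of "norm v"] show ?thesis by (simp add: e_def mult.assoc)
    qed
  qed
  note e = bounded_linear_Blinfun_apply[OF this]
  show thesis
  proof (rule that[of "Blinfun e"])
    have "range (blinfun_apply (Blinfun e)) \<subseteq> span {v}"
      unfolding e by (auto simp: e_def intro: span_scale span_base)
    then show "finite_rank (Blinfun e)"
      unfolding finite_rank_def by (intro exI[of _ "{v}"]) simp
    show "blinfun_apply (Blinfun e) (dirac q) = (h q - h base_point) *\<^sub>R v" for q
      by (simp add: e e_def functional_dirac delta.rep_eq f)
  qed
qed

section \<open>From punctured cutoffs to cutoffs\<close>

lemma cutoff_shrinking_tendsto_0:
  assumes "q \<noteq> p"
  shows "(\<lambda>k. cutoff {p} (1 / real (Suc k)) q) \<longlonglongrightarrow> 0"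
proof (rule tendsto_eventually)
  have "(\<lambda>k. 2 * inverse (real (Suc k))) \<longlonglongrightarrow> 2 * 0"
    by (intro tendsto_intros LIMSEQ_inverse_real_of_nat)
  then have "\<forall>\<^sub>F k in sequentially. 2 * inverse (real (Suc k)) < dist q p"
    by (rule order_tendstoD) (use assms in simp)
  then show "\<forall>\<^sub>F k in sequentially. cutoff {p} (1 / real (Suc k)) q = 0"
    by eventually_elim (auto intro!: cutoff_eq_0 simp: inverse_eq_divide)
qed

text \<open>The operators \<open>q \<mapsto> h(q)(\<delta>(q) - \<delta>(p))\<close> and \<open>q \<mapsto> h(q)\<delta>(q)\<close> agree up to rank one (the
  constant \<open>h(0)\<delta>(p)\<close> restores the value \<open>0\<close> at the base point), and in the former \<open>h\<close> may be cut
  off near \<open>p\<close> without losing uniform bounds.\<close>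

lemma approximable_on_cutoff_if_punctured:
  fixes p :: "'a::pointed_metric_space"
  assumes "r > 0"
    and appr: "\<And>k. approximable_on Y
      (weight_op (\<lambda>q. cutoff {p} r q * (1 - cutoff {p} (1 / real (Suc k)) q)))"
  shows "approximable_on Y (weight_op (cutoff {p} r))"
proof -
  define b where "b k q = 1 - cutoff {p} (1 / real (Suc k)) q" for k q
  define h where "h = cutoff {p} r"
  define g where "g k q = h q * b k q" for k q
  have b_le: "\<bar>b k q\<bar> \<le> 1" for k q
    using cutoff_nonneg[of "{p}" "1 / real (Suc k)" q] cutoff_le_1[of "{p}" "1 / real (Suc k)" q]
    by (simp add: b_def)
  have b_radial: "radial p 2 (b k)" for k
    using radial_cutoff[of "1 / real (Suc k)" p]
    by (simp add: radial_def b_def abs_minus_commute)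
  have h: "\<bar>h q\<bar> \<le> 1" "radial p 2 h" "weightable h" "(1 / r)-lipschitz_on UNIV h" for q
    unfolding h_def
    by (simp_all add: abs_cutoff_le_1 radial_cutoff weightable_cutoff cutoff_lipschitz \<open>r > 0\<close>)
  have g_le: "\<bar>g k q\<bar> \<le> 1" for k q
    using mult_mono[OF h(1) b_le] by (simp add: g_def abs_mult)
  \<comment> \<open>The constants 2 of \<open>h\<close> and \<open>b k\<close> add up. The bound
    does not depend on \<open>k\<close>, as the limit requires.\<close>
  have g_radial: "radial p 4 (g k)" for k
    using radial_mult[OF h(2,1) b_radial b_le] by (simp add: g_def[abs_def])
  have b_weightable: "weightable (b k)" for k
    unfolding b_def by (intro weightable_diff weightable_const weightable_cutoff) simp
  have g_weightable: "weightable (g k)" for k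
    unfolding g_def by (intro weightable_mult h b_weightable)
  have b_lip: "\<exists>L. L-lipschitz_on UNIV (b k)" for k
    unfolding b_def
    by (rule exI, rule lipschitz_on_diff[OF lipschitz_on_constant cutoff_lipschitz]) simp
  have g_lip: "\<exists>L. L-lipschitz_on UNIV (g k)" for k
  proof -
    obtain L where L: "L-lipschitz_on UNIV (b k)" using b_lip by blast
    have "(1 * L + 1 * (1 / r))-lipschitz_on UNIV (\<lambda>q. h q * b k q)"
      by (rule lipschitz_on_mult_bounded[OF h(4) _ L]) (simp_all add: h b_le)
    then show ?thesis unfolding g_def[abs_def] by blast
  qed
  have ext: "\<exists>R. norm R \<le> 1 + 4 \<and>
      (\<forall>q. blinfun_apply R (dirac q) = u q *\<^sub>R (dirac q - dirac p) + u base_point *\<^sub>R dirac p)"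
    if "\<And>q. \<bar>u q\<bar> \<le> 1" "radial p 4 u" for u
  proof -
    have "(1 + 4 + 0)-lipschitz_on UNIV
        (\<lambda>q. u q *\<^sub>R (dirac q - dirac p) + u base_point *\<^sub>R dirac p)"
      using that by (intro lipschitz_on_add lipschitz_on_weighted_dirac lipschitz_on_constant) auto
    then show ?thesis
      by (rule lipschitz_extension[where \<phi> = "\<lambda>q. u q *\<^sub>R (dirac q - dirac p) + u base_point *\<^sub>R dirac p"])
        (auto simp: algebra_simps)
  qed
  have "\<forall>k. \<exists>R. norm R \<le> 1 + 4 \<and>
      (\<forall>q. blinfun_apply R (dirac q) = g k q *\<^sub>R (dirac q - dirac p) + g k base_point *\<^sub>R dirac p)"
    by (intro allI ext g_le g_radial)
  then obtain R where R: "\<And>k. norm (R k) \<le> 1 + 4"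
    "\<And>k q. blinfun_apply (R k) (dirac q) = g k q *\<^sub>R (dirac q - dirac p) + g k base_point *\<^sub>R dirac p"
    by metis
  have h4: "radial p 4 h"
    using h(2) unfolding radial_def by (smt (verit) mult_right_mono zero_le_dist)
  obtain S where S: "blinfun_apply S (dirac q) = h q *\<^sub>R (dirac q - dirac p) + h base_point *\<^sub>R dirac p" for q
    using ext[OF h(1) h4] by blast
  have appr_g: "approximable_on Y (weight_op (g k))" for k
    unfolding g_def[abs_def] h_def b_def by (rule appr)
  have R_approx: "approximable_on Y (R k)" for k
  proof -
    obtain L where "L-lipschitz_on UNIV (g k)" using g_lip by blast
    then obtain E where E: "finite_rank E"
      "\<And>q. blinfun_apply E (dirac q) = (g k q - g k base_point) *\<^sub>R dirac p"
      by (rule rank_one_operator) blast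
    \<comment> \<open>On \<open>dirac q\<close> the right side is \<open>g k q\<close> times
      \<open>dirac q\<close> minus \<open>g k q - g k base_point\<close> times
      \<open>dirac p\<close>, a regrouping of the values of \<open>R k\<close>.\<close>
    have "R k = weight_op (g k) - E"
      by (rule lipschitz_free_blinfun_eqI)
        (simp add: R E blinfun.diff_left weight_op_dirac[OF g_weightable] algebra_simps)
    then show ?thesis
      using approximable_on_diff[OF appr_g approximable_on_finite_rank[OF E(1)]] by simp
  qed
  have g_lim: "(\<lambda>k. g k q) \<longlonglongrightarrow> h q" if "q \<noteq> p" for q
    unfolding g_def b_def
    by (rule tendsto_eq_intros cutoff_shrinking_tendsto_0[OF that] | simp)+
  have "approximable_on Y S"
  proof (rule approximable_on_limit[OF R_approx R(1) closure_span_dirac])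
    fix z :: "'a lipschitz_free" assume "z \<in> range dirac"
    then obtain q where q: "z = dirac q" by blast
    \<comment> \<open>At \<open>p\<close> the weights do not converge: \<open>g k p\<close> is 0 and
      \<open>h p\<close> is 1. This does no harm, since \<open>dirac q - dirac p\<close> vanishes
      for \<open>q = p\<close>; in the second limit \<open>dirac p\<close> vanishes if
      \<open>p\<close> is the base point.\<close>
    have "(\<lambda>k. g k q *\<^sub>R (dirac q - dirac p)) \<longlonglongrightarrow> h q *\<^sub>R (dirac q - dirac p)"
      by (cases "q = p") (auto intro!: tendsto_intros g_lim)
    moreover have "(\<lambda>k. g k base_point *\<^sub>R dirac p) \<longlonglongrightarrow> h base_point *\<^sub>R dirac p"
      by (cases "base_point = p") (auto intro!: tendsto_intros g_lim)
    ultimately show "(\<lambda>k. blinfun_apply (R k) z) \<longlonglongrightarrow> blinfun_apply S z"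
      unfolding q R S by (rule tendsto_add)
  qed
  moreover obtain E where E: "finite_rank E"
    "\<And>q. blinfun_apply E (dirac q) = (h q - h base_point) *\<^sub>R dirac p"
    using rank_one_operator[OF h(4)] by blast
  moreover have "weight_op h = S + E"
    by (rule lipschitz_free_blinfun_eqI)
      (simp add: S E blinfun.add_left weight_op_dirac[OF h(3)] algebra_simps)
  ultimately show ?thesis
    unfolding h_def using approximable_on_add approximable_on_finite_rank by fastforce
qed

section \<open>Decreasing sets with compact intersection\<close>

text \<open>Compactness is asked only of diagonal sequences: the intersection is compact and is
  approached by the \<open>K j\<close>, although no single \<open>K j\<close> has to be
  compact.\<close>

locale shrinking_sets =
  fixes K :: "nat \<Rightarrow> 'a::pointed_metric_space set"
  assumes decseq: "decseq K"
    and closed: "closed (K j)"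
    and convergent_subseq: "(\<And>j. x j \<in> K j) \<Longrightarrow> \<exists>l s. strict_mono s \<and> (x \<circ> s) \<longlonglongrightarrow> l"
begin

text \<open>Taking the intersection outside the closed span avoids having to show that it commutes with the
  latter.\<close>

definition limit_space :: "'a lipschitz_free set"
  where "limit_space = (\<Inter>j. closure (span (dirac ` K j)))"

lemma limit_mem:
  assumes x: "\<And>j. x j \<in> K j" and s: "strict_mono s" "(x \<circ> s) \<longlonglongrightarrow> l"
  shows "l \<in> (\<Inter>j. K j)"
proof
  fix j
  have "\<forall>\<^sub>F n in sequentially. (x \<circ> s) n \<in> K j"
    using eventually_ge_at_top[of j]
  proof eventually_elim
    case (elim n)
    then have "j \<le> s n" using seq_suble[OF s(1), of n] by linarith
    then show ?case using x decseqD[OF decseq] by auto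
  qed
  then show "l \<in> K j" by (rule Lim_in_closed_set[OF closed _ trivial_limit_sequentially s(2)])
qed

lemma compact_Inter: "compact (\<Inter>j. K j)"
  unfolding compact_def
proof (intro allI impI)
  fix x :: "nat \<Rightarrow> 'a" assume "\<forall>n. x n \<in> (\<Inter>j. K j)"
  then have x: "x n \<in> K n" for n by blast
  show "\<exists>l\<in>\<Inter>j. K j. \<exists>s. strict_mono s \<and> (x \<circ> s) \<longlonglongrightarrow> l"
    using convergent_subseq[OF x] limit_mem[OF x] by blast
qed

text \<open>Points of \<open>D\<close> chosen from each \<open>K j\<close> would accumulate in
  \<open>D\<close> and in the intersection. So an open cover of the intersection already covers some
  \<open>K j\<close>.\<close>

lemma eventually_disjoint:
  assumes "closed D" "D \<inter> (\<Inter>j. K j) = {}"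
  shows "\<exists>j. D \<inter> K j = {}"
proof (rule ccontr)
  assume "\<not> ?thesis"
  then have "\<forall>j. \<exists>q. q \<in> D \<and> q \<in> K j" by blast
  then obtain x where x: "\<And>j. x j \<in> D" "\<And>j. x j \<in> K j" by metis
  obtain l s where s: "strict_mono s" "(x \<circ> s) \<longlonglongrightarrow> l"
    using convergent_subseq[OF x(2)] by blast
  have "l \<in> D" by (rule closed_sequentially[OF assms(1) _ s(2)]) (simp add: x)
  with limit_mem[OF x(2) s] assms(2) show False by blast
qed

lemma weight_op_limit_space: "weightable h \<Longrightarrow> blinfun_apply (weight_op h) ` limit_space \<subseteq> limit_space"
  unfolding limit_space_def by (auto intro: weight_op_invariant)

lemma finite_partition:
  assumes "finite P"
    and "\<And>p. p \<in> P \<Longrightarrow> r p > 0 \<and> approximable_on limit_space (weight_op (cutoff {p} (r p)))"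
  shows "\<exists>u. weightable u \<and> approximable_on limit_space (weight_op u) \<and>
    (\<forall>p\<in>P. \<forall>q\<in>ball p (r p). u q = 1)"
  using assms
proof (induction P rule: finite_induct)
  case empty
  have "finite_rank (weight_op (\<lambda>_ :: 'a. 0))"
    unfolding finite_rank_def weight_op_const by (intro exI[of _ "{}"]) auto
  then show ?case
    by (intro exI[of _ "\<lambda>_. 0"]) (simp add: approximable_on_finite_rank weightable_const)
next
  case (insert p P)
  then obtain u where u: "weightable u" "approximable_on limit_space (weight_op u)"
    "\<And>p q. p \<in> P \<Longrightarrow> q \<in> ball p (r p) \<Longrightarrow> u q = 1"
    by blast
  define c where "c = cutoff {p} (r p)"
  have c: "weightable c" "approximable_on limit_space (weight_op c)"
    using insert.prems[of p] unfolding c_def by (simp_all add: weightable_cutoff)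
  have c1: "c q = 1" if "q \<in> ball p (r p)" for q
    using that insert.prems[of p] unfolding c_def by (intro cutoff_eq_1) (auto simp: dist_commute)
  \<comment> \<open>\<open>1 - v\<close> is \<open>(1 - u) * (1 - c)\<close>, so \<open>v\<close> is
    1 wherever \<open>u\<close> or \<open>c\<close> is.\<close>
  define v where "v q = (u q + c q) - u q * c q" for q
  have "weight_op v = (weight_op u + weight_op c) - (weight_op u o\<^sub>L weight_op c)"
    unfolding v_def[abs_def] using u(1) c(1)
    by (simp add: weight_op_diff weight_op_add weight_op_mult weightable_add weightable_mult)
  moreover have "approximable_on limit_space (weight_op u o\<^sub>L weight_op c)"
    by (intro approximable_on_compose u weight_op_limit_space c)
  ultimately have "approximable_on limit_space (weight_op v)"
    by (simp add: approximable_on_diff approximable_on_add u c)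
  moreover have "weightable v"
    unfolding v_def[abs_def] by (intro weightable_diff weightable_add weightable_mult u c)
  moreover have "v q = 1" if "p' \<in> insert p P" "q \<in> ball p' (r p')" for p' q
    using that u(3)[of p' q] c1[of q] by (auto simp: v_def)
  ultimately show ?case by blast
qed

text \<open>Finitely many good balls cover \<open>D\<close> within the intersection, hence within
  some \<open>K j\<close>. Their \<open>u\<close> satisfies \<open>u * g = g\<close> on
  \<open>K j\<close>, and on \<open>limit_space\<close> only the values on \<open>K j\<close>
  count.\<close>

lemma approximable_on_if_locally:
  assumes "closed D"
    and good: "\<And>p. p \<in> D \<Longrightarrow> \<exists>r>0. approximable_on limit_space (weight_op (cutoff {p} r))"
    and g: "weightable g" "\<And>q. q \<notin> D \<Longrightarrow> g q = 0"
  shows "approximable_on limit_space (weight_op g)"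
proof -
  obtain r where r: "\<And>p. p \<in> D \<Longrightarrow> r p > 0 \<and> approximable_on limit_space (weight_op (cutoff {p} (r p)))"
    using good by metis
  have "compact (D \<inter> (\<Inter>j. K j))"
    by (intro closed_Int_compact compact_Inter assms(1))
  then obtain P where P: "P \<subseteq> D" "finite P" "D \<inter> (\<Inter>j. K j) \<subseteq> (\<Union>p\<in>P. ball p (r p))"
    by (rule compactE_image[where C = D and f = "\<lambda>p. ball p (r p)"]) (use r in \<open>auto intro!: bexI\<close>)
  obtain u where u: "weightable u" "approximable_on limit_space (weight_op u)"
    "\<And>p q. p \<in> P \<Longrightarrow> q \<in> ball p (r p) \<Longrightarrow> u q = 1"
    using finite_partition[of P r] r P(1,2) by blast
  have "closed (D - (\<Union>p\<in>P. ball p (r p)))" by (intro closed_Diff assms(1)) auto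
  then obtain j where j: "(D - (\<Union>p\<in>P. ball p (r p))) \<inter> K j = {}"
    using eventually_disjoint P(3) by blast
  have "u q * g q = g q" if "q \<in> K j" for q
    using that j u(3) g(2) by (cases "q \<in> D") auto
  then have "blinfun_apply (weight_op (\<lambda>q. u q * g q)) x = blinfun_apply (weight_op g) x"
    if "x \<in> limit_space" for x
    using that unfolding limit_space_def
    by (intro weight_op_cong_on[where D = "K j"] weightable_mult u g) auto
  moreover have "approximable_on limit_space (weight_op (\<lambda>q. u q * g q))"
    unfolding weight_op_mult[OF u(1) g(1)]
    by (intro approximable_on_compose u weight_op_limit_space g)
  ultimately show ?thesis by (rule approximable_on_cong[rotated])
qed

lemma approximable_on_limit_space:
  assumes "scattered (UNIV :: 'a set)"
  shows "approximable_on limit_space id_blinfun"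
proof -
  \<comment> \<open>Scatteredness is applied once, to this set, in place of an induction on
    Cantor-Bendixson rank.\<close>
  define bad where "bad = {p. \<not> (\<exists>r>0. approximable_on limit_space (weight_op (cutoff {p} r)))}"
  have "bad = {}"
  proof (rule ccontr)
    assume "bad \<noteq> {}"
    then obtain p where "p isolated_in bad" using assms unfolding scattered_def by blast
    then obtain e where p: "p \<in> bad" and e: "e > 0" "\<And>y. y \<in> bad \<Longrightarrow> dist p y < e \<Longrightarrow> y = p"
      unfolding isolated_in_dist_Ex_iff by blast
    define r where "r = e / 3"
    have r: "r > 0" "2 * r < e" using e(1) by (simp_all add: r_def)
    have "approximable_on limit_space (weight_op (cutoff {p} r))"
    proof (rule approximable_on_cutoff_if_punctured[OF r(1)])
      fix k
      define s where "s = 1 / real (Suc k)"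
      have s: "s > 0" by (simp add: s_def)
      \<comment> \<open>The annulus carries the punctured cutoff and avoids \<open>bad\<close>: the
        inner radius excludes \<open>p\<close>, and \<open>2 * r < e\<close> excludes all other bad
        points.\<close>
      let ?D = "{q. s \<le> dist q p \<and> dist q p \<le> 2 * r}"
      show "approximable_on limit_space
          (weight_op (\<lambda>q. cutoff {p} r q * (1 - cutoff {p} (1 / real (Suc k)) q)))"
        unfolding s_def[symmetric]
      proof (rule approximable_on_if_locally)
        show "closed ?D"
          by (intro closed_Collect_conj closed_Collect_le continuous_intros)
        show "\<exists>r>0. approximable_on limit_space (weight_op (cutoff {q} r))" if "q \<in> ?D" for q
        proof -
          have "q \<notin> bad" using that e(2)[of q] r s by (auto simp: dist_commute)
          then show ?thesis by (simp add: bad_def)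
        qed
        show "weightable (\<lambda>q. cutoff {p} r q * (1 - cutoff {p} s q))"
          by (intro weightable_mult weightable_diff weightable_const weightable_cutoff r s)
        show "cutoff {p} r q * (1 - cutoff {p} s q) = 0" if "q \<notin> ?D" for q
        proof (cases "dist q p \<le> s")
          case True
          then show ?thesis using s by (simp add: cutoff_eq_1)
        next
          case False
          with that r(1) show ?thesis by (simp add: cutoff_eq_0)
        qed
      qed
    qed
    with p r(1) show False unfolding bad_def by blast
  qed
  then have "approximable_on limit_space (weight_op (\<lambda>_. 1))"
    by (intro approximable_on_if_locally[where D = UNIV] weightable_const)
      (auto simp: bad_def)
  then show ?thesis by (simp add: weight_op_const)
qed

end

section \<open>Compact reduction\<close>

text \<open>The range is totally bounded: at each precision one finite \<open>F i\<close> takes care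
  of all terms after the first few, which serve as their own centres.\<close>

lemma complete_convergent_subseq:
  fixes x :: "nat \<Rightarrow> 'a::metric_space"
  assumes complete: "complete (UNIV :: 'a set)"
    and F: "\<And>i. finite (F i)" "\<And>i. F i \<noteq> {}"
    and r: "r \<longlonglongrightarrow> 0"
    and x: "\<And>i j. i < j \<Longrightarrow> infdist (x j) (F i) \<le> r i"
  shows "\<exists>l s. strict_mono s \<and> (x \<circ> s) \<longlonglongrightarrow> l"
proof -
  have "complete (closure (range x))"
    using complete_Int_closed[OF complete, of "closure (range x)"] by simp
  moreover have "\<exists>N. finite N \<and> closure (range x) \<subseteq> (\<Union>c\<in>N. ball c e)" if "e > 0" for e
  proof -
    have "\<exists>i. r i < e / 2"
      by (rule eventually_happens'[OF sequentially_bot order_tendstoD(2)[OF r]]) (use that in simp)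
    then obtain i where i: "r i < e / 2" by blast
    let ?N = "F i \<union> x ` {..i}"
    have "\<exists>c\<in>?N. dist c y < e" if "y \<in> closure (range x)" for y
    proof -
      have "\<exists>z\<in>range x. dist z y < e / 2"
        using that half_gt_zero[OF \<open>e > 0\<close>] unfolding closure_approachable by blast
      then obtain n where n: "dist (x n) y < e / 2" by blast
      show ?thesis
      proof (cases "n \<le> i")
        case True
        then show ?thesis using n \<open>e > 0\<close> by (intro bexI[of _ "x n"]) auto
      next
        case False
        then have "infdist (x n) (F i) < e / 2" using x[of i n] i by simp
        then have "(INF a\<in>F i. dist (x n) a) < e / 2" by (simp add: infdist_notempty F(2))
        then obtain a where a: "a \<in> F i" "dist (x n) a < e / 2"
          by (subst (asm) cINF_less_iff) (auto simp: F(2))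
        then have "dist a y < e"
          using n dist_triangle_less_add[of a "x n" "e / 2" y "e / 2"] by (simp add: dist_commute)
        with a(1) show ?thesis by blast
      qed
    qed
    then have "closure (range x) \<subseteq> (\<Union>c\<in>?N. ball c e)"
      unfolding subset_iff UN_iff mem_ball by blast
    then show ?thesis using F(1) by (intro exI[of _ ?N]) simp
  qed
  ultimately have "seq_compact (closure (range x))"
    by (simp add: compact_eq_totally_bounded flip: compact_eq_seq_compact_metric)
  moreover have "\<forall>n. x n \<in> closure (range x)" by (simp add: subsetD[OF closure_subset])
  ultimately show ?thesis by (meson seq_compactE)
qed

lemma compact_near_finite_span_dirac:
  fixes W :: "'a::pointed_metric_space lipschitz_free set"
  assumes "compact W" "\<eta> > 0"
  shows "\<exists>F. finite F \<and> F \<noteq> {} \<and> (\<forall>x\<in>W. \<exists>z\<in>span (dirac ` F). norm (x - z) \<le> \<eta>)"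
proof -
  obtain N where N: "finite N" "W \<subseteq> (\<Union>y\<in>N. ball y (\<eta> / 2))"
    using assms half_gt_zero unfolding compact_eq_totally_bounded by blast
  have "\<exists>F z. finite F \<and> z \<in> span (dirac ` F) \<and> dist z y < \<eta> / 2" for y :: "'a lipschitz_free"
  proof -
    have "y \<in> closure (span (range dirac))" by (simp add: closure_span_dirac)
    then obtain z where z: "z \<in> span (range dirac)" "dist z y < \<eta> / 2"
      using half_gt_zero[OF assms(2)] unfolding closure_approachable by blast
    from z(1) obtain t c where t: "finite t" "t \<subseteq> range dirac" "z = (\<Sum>a\<in>t. c a *\<^sub>R a)"
      unfolding span_explicit by blast
    then obtain F where F: "finite F" "t = dirac ` F"
      by (meson finite_subset_image)
    have "z \<in> span (dirac ` F)"
      unfolding t(3) F(2)[symmetric] by (intro span_sum span_scale span_base)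
    with F(1) z(2) show ?thesis by blast
  qed
  then obtain F z where F: "\<And>y. finite (F y)" "\<And>y. z y \<in> span (dirac ` F y)"
    "\<And>y :: 'a lipschitz_free. dist (z y) y < \<eta> / 2"
    by metis
  \<comment> \<open>The base point keeps the set nonempty even if \<open>W\<close> is empty.\<close>
  let ?F = "insert base_point (\<Union>y\<in>N. F y)"
  have "\<exists>z\<in>span (dirac ` ?F). norm (x - z) \<le> \<eta>" if x: "x \<in> W" for x
  proof -
    obtain y where y: "y \<in> N" "dist y x < \<eta> / 2" using N(2) x by auto
    have "z y \<in> span (dirac ` ?F)"
      using F(2)[of y] y(1) span_mono[of "dirac ` F y" "dirac ` ?F"] by blast
    moreover have "norm (x - z y) \<le> \<eta>"
      using y(2) F(3)[of y] dist_triangle[of x "z y" y] by (simp add: dist_commute dist_norm)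
    ultimately show ?thesis by blast
  qed
  then show ?thesis using N(1) F(1) by (intro exI[of _ ?F]) auto
qed

text \<open>The norms are at most 3 at all radii and each \<open>dirac q\<close> is eventually
  fixed. The bounded support obtained here is what later bounds the operators of the
  products.\<close>

lemma cutoff_growing_approximates_id:
  fixes W :: "'a::pointed_metric_space lipschitz_free set"
  assumes "compact W" "\<epsilon> > 0"
  obtains R where "R > 0" "\<And>x. x \<in> W \<Longrightarrow> norm (blinfun_apply (weight_op (cutoff {base_point} R)) x - x) < \<epsilon>"
proof -
  let ?T = "\<lambda>k. weight_op (cutoff {base_point :: 'a} (real (Suc k)))"
  have "\<forall>\<^sub>F k in sequentially. \<forall>x\<in>W. norm (blinfun_apply (?T k) x - blinfun_apply id_blinfun x) < \<epsilon>"
  proof (rule uniform_on_compact[OF assms(1) _ closure_span_dirac _ assms(2)])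
    show "norm (?T k) \<le> 1 + 2" for k
      by (intro norm_weight_op_radial abs_cutoff_le_1 radial_cutoff) auto
    fix z :: "'a lipschitz_free" assume "z \<in> range dirac"
    then obtain q where q: "z = dirac q" by blast
    show "(\<lambda>k. blinfun_apply (?T k) z) \<longlonglongrightarrow> blinfun_apply id_blinfun z"
    proof (rule tendsto_eventually)
      obtain n :: nat where "dist q base_point \<le> real n" using real_arch_simple by blast
      then have "cutoff {base_point} (real (Suc k)) q = 1" if "k \<ge> n" for k
        using that by (intro cutoff_eq_1) auto
      then show "\<forall>\<^sub>F k in sequentially. blinfun_apply (?T k) z = blinfun_apply id_blinfun z"
        unfolding eventually_sequentially q
        by (intro exI[of _ n]) (simp add: weight_op_dirac weightable_cutoff)
    qed
  qed
  from eventually_happens'[OF sequentially_bot this]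
  obtain k where "\<forall>x\<in>W. norm (blinfun_apply (?T k) x - x) < \<epsilon>" by auto
  then show thesis by (intro that[of "real (Suc k)"]) auto
qed

text \<open>The scales \<open>2\<^sup>-\<^sup>j\<close> fix the norms of the operators \<open>weight_op (g j)\<close> in advance, whatever the
  finite sets \<open>F j\<close> are. So \<open>F j\<close> can be chosen fine enough that multiplying \<open>g j\<close> by the cutoff
  around \<open>F j\<close> moves \<open>W\<close> by less than a prescribed summable error.\<close>

lemma compact_reduction:
  fixes W :: "'a::pointed_metric_space lipschitz_free set"
  assumes complete: "complete (UNIV :: 'a set)" and W: "compact W" and \<epsilon>: "\<epsilon> > 0"
  obtains K :: "nat \<Rightarrow> 'a set" and T :: "nat \<Rightarrow> 'a lipschitz_free \<Rightarrow>\<^sub>L 'a lipschitz_free" and t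
  where "shrinking_sets K"
    and "uniform_limit W (\<lambda>j. blinfun_apply (T j)) t sequentially"
    and "t ` W \<subseteq> shrinking_sets.limit_space K"
    and "\<And>x. x \<in> W \<Longrightarrow> norm (t x - x) \<le> \<epsilon>"
proof -
  obtain R where R: "R > 0"
    "\<And>x. x \<in> W \<Longrightarrow> norm (blinfun_apply (weight_op (cutoff {base_point} R)) x - x) < \<epsilon> / 2"
    using cutoff_growing_approximates_id[OF W half_gt_zero[OF \<epsilon>]] by blast
  define r :: "nat \<Rightarrow> real" where "r j = (1 / 2) ^ j" for j
  have r: "r j > 0" for j by (simp add: r_def)
  \<comment> \<open>\<open>L j\<close> is a Lipschitz constant of the product \<open>g j\<close>
    below, whose factors are bounded by 1. As \<open>g j\<close> vanishes at distance
    \<open>2 * R\<close> and beyond from the base point, \<open>C j\<close> bounds the norm of its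
    operator.\<close>
  define L where "L j = 1 / R + (\<Sum>i<j. 1 / r i)" for j
  have L: "L j \<ge> 0" for j
    unfolding L_def by (intro add_nonneg_nonneg sum_nonneg) (use r R in \<open>auto intro: less_imp_le\<close>)
  define C where "C j = 1 + L j * (2 * R)" for j
  have C: "C j > 0" for j using L[of j] R(1) unfolding C_def by (simp add: add_pos_nonneg)
  \<comment> \<open>These errors sum to \<open>\<epsilon> / 2\<close>; the other half is spent on
    the cutoff at radius \<open>R\<close>. The divisor \<open>C (Suc j) + C j\<close> in the choice
    of \<open>F j\<close> bounds the difference of consecutive operators.\<close>
  define M where "M j = \<epsilon> / 2 * (1 / 2) ^ Suc j" for j
  have "\<forall>j. \<exists>F. finite F \<and> F \<noteq> {} \<and>
      (\<forall>x\<in>W. \<exists>z\<in>span (dirac ` F). norm (x - z) \<le> M j / (C (Suc j) + C j))"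
    using C \<epsilon> by (intro allI compact_near_finite_span_dirac[OF W]) (simp add: M_def add_pos_pos)
  then obtain F where F: "\<And>j. finite (F j)" "\<And>j. F j \<noteq> {}"
    and F_near: "\<And>j x. x \<in> W \<Longrightarrow> \<exists>z\<in>span (dirac ` F j). norm (x - z) \<le> M j / (C (Suc j) + C j)"
    by metis
  define g where "g j q = cutoff {base_point} R q * (\<Prod>i<j. cutoff (F i) (r i) q)" for j q
  have g_Suc: "g (Suc j) q = g j q * cutoff (F j) (r j) q" for j q
    by (simp add: g_def mult.assoc)
  have g_le: "\<bar>g j q\<bar> \<le> 1" for j q
  proof -
    have "0 \<le> (\<Prod>i<j. cutoff (F i) (r i) q)" "(\<Prod>i<j. cutoff (F i) (r i) q) \<le> 1"
      by (auto intro: prod_nonneg prod_le_1 simp: cutoff_nonneg cutoff_le_1)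
    then show ?thesis
      unfolding g_def abs_mult by (intro mult_le_one) (auto simp: abs_cutoff_le_1)
  qed
  have g_lip: "(L j)-lipschitz_on UNIV (g j)" for j
  proof (induction j)
    case 0
    show ?case using cutoff_lipschitz[OF R(1)] by (simp add: g_def[abs_def] L_def)
  next
    case (Suc j)
    have "(1 * (1 / r j) + 1 * L j)-lipschitz_on UNIV (\<lambda>q. g j q * cutoff (F j) (r j) q)"
      by (rule lipschitz_on_mult_bounded[OF Suc _ cutoff_lipschitz[OF r]])
        (simp_all add: g_le abs_cutoff_le_1)
    moreover have "(\<lambda>q. g j q * cutoff (F j) (r j) q) = g (Suc j)" by (rule ext) (simp add: g_Suc)
    moreover have "1 * (1 / r j) + 1 * L j = L (Suc j)" by (simp add: L_def)
    ultimately show ?case by (simp only:)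
  qed
  have g_radial: "radial base_point (L j * (2 * R)) (g j)" for j
    using R(1) by (intro radial_if_bounded_support[OF g_lip]) (simp_all add: g_def cutoff_eq_0)
  have g_weightable: "weightable (g j)" and g_norm: "norm (weight_op (g j)) \<le> C j" for j
    using weightable_radial[OF g_le g_radial] norm_weight_op_radial[OF g_le g_radial] L R(1)
    by (simp_all add: C_def)
  \<comment> \<open>The \<open>i\<close>-th cutoff vanishes at distance \<open>2 * r i\<close> from
    \<open>F i\<close> and beyond, so \<open>g j\<close> vanishes off \<open>K j\<close>.
    \<open>K 0\<close> is the whole space.\<close>
  define K where "K j = {q. \<forall>i<j. infdist q (F i) \<le> 2 * r i}" for j
  have K: "shrinking_sets K"
  proof
    show "decseq K" unfolding decseq_def K_def by auto
    show "closed (K j)" for j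
    proof -
      have "K j = (\<Inter>i\<in>{..<j}. {q. infdist q (F i) \<le> 2 * r i})" by (auto simp: K_def)
      also have "closed \<dots>" by (intro closed_INT ballI closed_Collect_le continuous_intros)
      finally show ?thesis .
    qed
    have "(\<lambda>i. 2 * r i) \<longlonglongrightarrow> 2 * 0"
      unfolding r_def by (intro tendsto_intros LIMSEQ_power_zero) simp
    then show "\<exists>l s. strict_mono s \<and> (x \<circ> s) \<longlonglongrightarrow> l" if "\<And>j. x j \<in> K j" for x
      using that by (intro complete_convergent_subseq[OF complete F, of "\<lambda>i. 2 * r i"]) (auto simp: K_def)
  qed
  define T where "T j = weight_op (g j)" for j
  have step: "norm (blinfun_apply (T (Suc j)) x - blinfun_apply (T j) x) \<le> M j" if x: "x \<in> W" for j x
  proof -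
    obtain z where z: "z \<in> span (dirac ` F j)" "norm (x - z) \<le> M j / (C (Suc j) + C j)"
      using F_near[OF x] by blast
    \<comment> \<open>The new factor is 1 on \<open>F j\<close>, so consecutive operators agree on
      its span and only the small remainder \<open>x - z\<close> is moved.\<close>
    have "g (Suc j) q = g j q" if "q \<in> F j" for q
      using that r[of j] by (simp add: g_Suc cutoff_eq_1)
    then have "blinfun_apply (T (Suc j)) z = blinfun_apply (T j) z"
      unfolding T_def using z(1)
      by (intro weight_op_cong_on[where D = "F j"] g_weightable subsetD[OF closure_subset])
    then have "blinfun_apply (T (Suc j)) x - blinfun_apply (T j) x = blinfun_apply (T (Suc j) - T j) (x - z)"
      by (simp add: blinfun.diff_left blinfun.diff_right)
    also have "norm \<dots> \<le> norm (T (Suc j) - T j) * norm (x - z)" by (rule norm_blinfun)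
    also have "\<dots> \<le> (C (Suc j) + C j) * (M j / (C (Suc j) + C j))"
      using norm_triangle_ineq4[of "T (Suc j)" "T j"] g_norm[of "Suc j"] g_norm[of j] z(2) C
      by (intro mult_mono) (auto simp: T_def intro: add_nonneg_nonneg less_imp_le)
    also have "\<dots> = M j" using C[of "Suc j"] C[of j] by simp
    finally show ?thesis .
  qed
  have M_sums: "M sums (\<epsilon> / 2)"
    using sums_mult[OF power_half_series, of "\<epsilon> / 2"] unfolding M_def[abs_def] by simp
  \<comment> \<open>The bounds \<open>C j\<close> grow with \<open>j\<close>, so the limit is taken
    only as a function, uniformly on \<open>W\<close>.\<close>
  define t where
    "t x = blinfun_apply (T 0) x + (\<Sum>j. blinfun_apply (T (Suc j)) x - blinfun_apply (T j) x)" for x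
  have lim: "uniform_limit W (\<lambda>j. blinfun_apply (T j)) t sequentially"
  proof -
    have telescope: "blinfun_apply (T 0) x + (\<Sum>j<n. blinfun_apply (T (Suc j)) x - blinfun_apply (T j) x)
        = blinfun_apply (T n) x" for n x
      using sum_lessThan_telescope[of "\<lambda>j. blinfun_apply (T j) x" n] by simp
    have "uniform_limit W (\<lambda>n x. \<Sum>j<n. blinfun_apply (T (Suc j)) x - blinfun_apply (T j) x)
        (\<lambda>x. \<Sum>j. blinfun_apply (T (Suc j)) x - blinfun_apply (T j) x) sequentially"
      using step sums_summable[OF M_sums] by (intro Weierstrass_m_test) auto
    from uniform_limit_add[OF uniform_limit_const[where c = "blinfun_apply (T 0)"] this]
    show ?thesis unfolding telescope t_def[abs_def] .
  qed
  show thesis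
  proof (rule that[OF K lim])
    interpret shrinking_sets K by (rule K)
    show "t ` W \<subseteq> limit_space"
    proof (clarsimp simp: limit_space_def)
      fix x j assume "x \<in> W"
      then have "(\<lambda>n. blinfun_apply (T n) x) \<longlonglongrightarrow> t x" by (rule tendsto_uniform_limitI[OF lim])
      moreover have "blinfun_apply (T n) x \<in> closure (span (dirac ` K j))" if "n \<ge> j" for n
        unfolding T_def
      proof (rule weight_op_supported[OF g_weightable])
        fix q assume "q \<notin> K j"
        then obtain i where "i < j" "2 * r i \<le> infdist q (F i)" by (force simp: K_def)
        with r[of i] \<open>n \<ge> j\<close> have "i < n" "cutoff (F i) (r i) q = 0" by (simp_all add: cutoff_eq_0)
        then have "(\<Prod>i<n. cutoff (F i) (r i) q) = 0" by (intro prod_zero) auto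
        then show "g n q = 0" by (simp add: g_def)
      qed
      ultimately show "t x \<in> closure (span (dirac ` K j))"
        by (intro Lim_in_closed_set[OF closed_closure]) (auto simp: eventually_sequentially)
    qed
    fix x assume x: "x \<in> W"
    have "norm (t x - blinfun_apply (T 0) x) \<le> suminf M"
      unfolding t_def using step[OF x] sums_summable[OF M_sums] by (simp add: norm_suminf_le)
    moreover have "norm (blinfun_apply (T 0) x - x) < \<epsilon> / 2"
      using R(2)[OF x] by (simp add: T_def g_def[abs_def])
    moreover have "suminf M = \<epsilon> / 2" using M_sums by (rule sums_unique[symmetric])
    ultimately show "norm (t x - x) \<le> \<epsilon>"
      using norm_triangle_ineq[of "t x - blinfun_apply (T 0) x" "blinfun_apply (T 0) x - x"] by simp
  qed
qed

section \<open>The approximation property for scattered and for countable spaces\<close>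

lemma approximation_property_if_scattered:
  assumes complete: "complete (UNIV :: 'a::pointed_metric_space set)"
    and scattered: "scattered (UNIV :: 'a set)"
  shows "approximation_property TYPE('a lipschitz_free)"
  unfolding approximation_property_def
proof (intro allI impI)
  fix \<epsilon> :: real and W :: "'a lipschitz_free set" assume "\<epsilon> > 0" and W: "compact W"
  then have \<epsilon>: "\<epsilon> / 3 > 0" by simp
  obtain K :: "nat \<Rightarrow> 'a set" and T t where K: "shrinking_sets K"
    and T: "uniform_limit W (\<lambda>j. blinfun_apply (T j)) t sequentially"
    and t: "t ` W \<subseteq> shrinking_sets.limit_space K" "\<And>x. x \<in> W \<Longrightarrow> norm (t x - x) \<le> \<epsilon> / 3"
    using compact_reduction[OF complete W \<epsilon>] by blast
  interpret shrinking_sets K by (rule K)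
  have "continuous_on W t"
    by (rule uniform_limit_theorem[OF _ T]) (auto intro!: always_eventually continuous_intros)
  then have "compact (t ` W)" by (rule compact_continuous_image[OF _ W])
  then obtain S where S: "finite_rank S" "\<And>x. x \<in> W \<Longrightarrow> norm (blinfun_apply S (t x) - t x) \<le> \<epsilon> / 3"
    using approximable_onD[OF approximable_on_limit_space[OF scattered] _ t(1) \<epsilon>] by auto
  define e where "e = \<epsilon> / 3 / (norm S + 1)"
  have "norm S + 1 > 0" using norm_ge_zero[of S] by linarith
  then have e: "e > 0" "norm S * e \<le> \<epsilon> / 3"
    using \<epsilon> by (simp_all add: e_def field_simps)
  from eventually_happens'[OF sequentially_bot uniform_limitD[OF T e(1)]]
  obtain j where j: "\<And>x. x \<in> W \<Longrightarrow> norm (blinfun_apply (T j) x - t x) < e"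
    by (auto simp: dist_norm)
  have "norm (blinfun_apply (S o\<^sub>L T j) x - x) \<le> \<epsilon>" if x: "x \<in> W" for x
  proof -
    have "norm (blinfun_apply S (blinfun_apply (T j) x - t x)) \<le> norm S * norm (blinfun_apply (T j) x - t x)"
      by (rule norm_blinfun)
    also have "\<dots> \<le> norm S * e" using j[OF x] by (intro mult_left_mono) auto
    finally have "norm (blinfun_apply S (blinfun_apply (T j) x - t x)) \<le> \<epsilon> / 3" using e(2) by linarith
    moreover have "blinfun_apply (S o\<^sub>L T j) x - x = blinfun_apply S (blinfun_apply (T j) x - t x)
        + (blinfun_apply S (t x) - t x) + (t x - x)"
      by (simp add: blinfun.diff_right)
    ultimately show ?thesis
      using S(2)[OF x] t(2)[OF x]
        norm_triangle_ineq[of "blinfun_apply S (blinfun_apply (T j) x - t x)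
          + (blinfun_apply S (t x) - t x)" "t x - x"]
        norm_triangle_ineq[of "blinfun_apply S (blinfun_apply (T j) x - t x)" "blinfun_apply S (t x) - t x"]
      by simp
  qed
  then show "\<exists>S. finite_rank S \<and> (\<forall>x\<in>W. norm (blinfun_apply S x - x) \<le> \<epsilon>)"
    using finite_rank_compose_left[OF S(1)] by blast
qed

text \<open>The closure of a nonempty set without isolated points is perfect, and a nonempty perfect
  set in a completely metrizable space has at least the cardinality of the continuum.\<close>

lemma complete_countable_imp_scattered:
  assumes complete: "complete (UNIV :: 'a::metric_space set)" and count: "countable (UNIV :: 'a set)"
  shows "scattered (UNIV :: 'a set)"
  unfolding scattered_def
proof (intro allI impI, rule ccontr)
  fix A :: "'a set" assume A: "A \<noteq> {}" "\<nexists>x. x isolated_in A"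
  have limpt: "x islimpt A" if "x \<in> closure A" for x
    using that A(2) unfolding closure_def isolated_in_islimpt_iff by blast
  have "euclidean derived_set_of closure A = {x. x islimpt closure A}"
    by (auto simp: derived_set_of_def islimpt_def)
  also have "\<dots> = closure A"
    unfolding limpt_of_closure using limpt by (auto simp: closure_def)
  finally have "euclidean derived_set_of closure A = closure A" .
  moreover have "completely_metrizable_space (euclidean :: 'a topology)"
    using Met_TC.completely_metrizable_space_mtopology complete by simp
  ultimately have "(UNIV :: real set) \<lesssim> closure A"
    using A(1) by (intro lepoll_perfect_set) auto
  then have "countable (UNIV :: real set)"
    using countable_lepoll countable_subset[OF subset_UNIV count] by blast
  then show False using uncountable_UNIV_real by blast
qed

theorem corollary2p9:
  assumes "complete (UNIV :: 'a::pointed_metric_space set)"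
  shows "(countable (UNIV :: 'a set) \<longrightarrow> approximation_property TYPE('a lipschitz_free)) \<and>
         (scattered (UNIV :: 'a set) \<longrightarrow> approximation_property TYPE('a lipschitz_free))"
  using approximation_property_if_scattered[OF assms] complete_countable_imp_scattered[OF assms] by blast

end
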